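(* Let $n\geq 2$. For $k\in \mathbb{N}$, let $\overline{R}_{k}^{\mathcal{D}}$ denote any cuboid which minimises the average $\frac{1}{k}\sum_{i=1}^k\lambda_i(R)$ among all $n$-dimensional cuboids $R$ of unit measure, and let $\bar a_{1,k}^*\le\dots\le\bar a_{n,k}^*$ be its side-lengths. Then, for any admissible exponent $\theta_n$ (as defined in the context), as $k \to \infty$, $$\bar{a}_{n,k}^* = 1+O\bigl(k^{(\theta_n-(n-1))/(2n)}\bigr).$$
   Context: $\mathbb{N}=\{1,2,\dots\}$. An $n$-dimensional cuboid of unit measure is a domain $R=\prod_{i=1}^n (0,a_i)\subset\mathbb{R}^n$ with $a_i>0$, $\prod_{i=1}^n a_i=1$, with side-lengths labelled so that $a_1\le\dots\le a_n$. $\lambda_1(R)\le\lambda_2(R)\le\dots$ are the eigenvalues of the Dirichlet Laplacian on $R$, repeated according to multiplicity: the numbers $\sum_{j=1}^n \pi^2 i_j^2/a_j^2$ with $i_j$ positive integers, in non-decreasing order. A minimising cuboid exists for every $k$ (it need not be unique). Admissible exponent: $\theta_n$ denotes any exponent such that for all $a_1,\dots,a_n>0$, $$\#\{z\in\mathbb{Z}^n: a_1^{-2}z_1^2+\dots+a_n^{-2}z_n^2\le t^2\}-\omega_n t^n\prod_{i=1}^n a_i = O(t^{\theta_n}),\quad t\to\infty,$$ uniformly for $a_1,\dots,a_n$ in compact subsets of $(0,\infty)$, where $\omega_n$ is the volume of the unit ball in $\mathbb{R}^n$. It is known that for every $n\ge2$ there are admissible exponents with $\theta_n<n-1$. *)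

theory Defs
  imports "HOL-Analysis.Analysis" "HOL-Library.Landau_Symbols"
begin

text \<open>
  A function \<open>a :: nat \<Rightarrow> real\<close> represents the cuboid \<open>(0, a 1) \<times> \<dots> \<times> (0, a n)\<close>;
  its values outside \<open>{1..n}\<close> are irrelevant.
\<close>

definition unit_cuboid :: "nat \<Rightarrow> (nat \<Rightarrow> real) \<Rightarrow> bool" where
  "unit_cuboid n a \<longleftrightarrow>
     (\<forall>i\<in>{1..n}. 0 < a i) \<and> (\<Prod>i=1..n. a i) = 1 \<and> mono_on {1..n} a"

definition modes :: "nat \<Rightarrow> (nat \<Rightarrow> nat) set" where
  "modes n = ({1..n} \<rightarrow>\<^sub>E {1..})"

definition mode_value :: "nat \<Rightarrow> (nat \<Rightarrow> real) \<Rightarrow> (nat \<Rightarrow> nat) \<Rightarrow> real" where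
  "mode_value n a i = (\<Sum>j=1..n. pi\<^sup>2 * (real (i j))\<^sup>2 / (a j)\<^sup>2)"

text \<open>
  \<open>e 1, e 2, \<dots>\<close> runs through \<open>I\<close>, each index exactly once, in non-decreasing order of
  the values of \<open>f\<close>. Listing the indices rather than the values is what makes a value
  appear as often as its multiplicity.
\<close>

definition nondecreasing_listing :: "'a set \<Rightarrow> ('a \<Rightarrow> real) \<Rightarrow> (nat \<Rightarrow> 'a) \<Rightarrow> bool" where
  "nondecreasing_listing I f e \<longleftrightarrow> bij_betw e {1..} I \<and> mono_on {1..} (\<lambda>k. f (e k))"

text \<open>
  The numbering starts at \<open>k = 1\<close>. A listing exists by
  \<open>dirichlet_listing_exists\<close> below, and the value does not depend on the chosen one by
  \<open>dirichlet_eigenvalue_eq\<close>.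
\<close>

definition dirichlet_eigenvalue :: "nat \<Rightarrow> (nat \<Rightarrow> real) \<Rightarrow> nat \<Rightarrow> real" where
  "dirichlet_eigenvalue n a k =
     mode_value n a ((SOME e. nondecreasing_listing (modes n) (mode_value n a) e) k)"

definition eigenvalue_average :: "nat \<Rightarrow> nat \<Rightarrow> (nat \<Rightarrow> real) \<Rightarrow> real" where
  "eigenvalue_average n k a = 1 / real k * (\<Sum>i=1..k. dirichlet_eigenvalue n a i)"

definition minimising_cuboid :: "nat \<Rightarrow> nat \<Rightarrow> (nat \<Rightarrow> real) \<Rightarrow> bool" where
  "minimising_cuboid n k a \<longleftrightarrow>
     unit_cuboid n a \<and>
     (\<forall>b. unit_cuboid n b \<longrightarrow> eigenvalue_average n k a \<le> eigenvalue_average n k b)"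

definition ellipsoid_lattice_points :: "nat \<Rightarrow> (nat \<Rightarrow> real) \<Rightarrow> real \<Rightarrow> (nat \<Rightarrow> int) set" where
  "ellipsoid_lattice_points n a t =
     {z \<in> {1..n} \<rightarrow>\<^sub>E UNIV. (\<Sum>i=1..n. (real_of_int (z i))\<^sup>2 / (a i)\<^sup>2) \<le> t\<^sup>2}"

text \<open>
  Uniformity: the constant and the threshold for \<open>t\<close> depend only on the compact set \<open>K\<close>
  containing all the semi-axes.
\<close>

definition admissible_exponent :: "nat \<Rightarrow> real \<Rightarrow> bool" where
  "admissible_exponent n \<theta> \<longleftrightarrow>
     (\<forall>K. compact K \<and> K \<subseteq> {0<..} \<longrightarrow>
        (\<exists>C. \<forall>\<^sub>F t in at_top. \<forall>a. (\<forall>i\<in>{1..n}. a i \<in> K) \<longrightarrow>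
           \<bar>real (card (ellipsoid_lattice_points n a t))
              - unit_ball_vol (real n) * t ^ n * (\<Prod>i=1..n. a i)\<bar> \<le> C * t powr \<theta>))"

lemma nondecreasing_listing_exists:
  fixes f :: "'a \<Rightarrow> real"
  assumes inf: "infinite I" and fin: "\<And>x. finite {i \<in> I. f i \<le> x}"
  shows "\<exists>e. nondecreasing_listing I f e"
proof -
  have "I \<subseteq> (\<Union>m::nat. {i \<in> I. f i \<le> real m})"
    using real_arch_simple by blast
  moreover have "countable (\<Union>m::nat. {i \<in> I. f i \<le> real m})"
    using fin by (intro countable_UN) (auto intro: countable_finite)
  ultimately have "countable I"
    by (rule countable_subset)
  define g where "g = to_nat_on I"
  have g: "inj_on g I"
    unfolding g_def using \<open>countable I\<close> by (rule inj_on_to_nat_on)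
  define P where "P y x \<longleftrightarrow> f y < f x \<or> f y = f x \<and> g y < g x" for y x
  define r where "r x = card {y \<in> I. P y x}" for x
  have finP: "finite {y \<in> I. P y x}" for x
    by (rule finite_subset[OF _ fin[of "f x"]]) (auto simp: P_def)
  have mono: "r y < r x" if "y \<in> I" "P y x" for x y
    unfolding r_def
  proof (rule psubset_card_mono[OF finP])
    have "{z \<in> I. P z y} \<subseteq> {z \<in> I. P z x}" "y \<notin> {z \<in> I. P z y}"
      using that by (auto simp: P_def)
    with that show "{z \<in> I. P z y} \<subset> {z \<in> I. P z x}"
      by blast
  qed
  have total: "P y x \<or> P x y" if "x \<in> I" "y \<in> I" "x \<noteq> y" for x y
    using that g unfolding P_def inj_on_def by (meson linorder_neqE)
  have inj: "inj_on r I"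
    by (rule inj_onI) (metis mono total less_irrefl)
  have initial: "r ` {y \<in> I. P y x} = {..<r x}" for x
  proof (rule card_subset_eq)
    show "r ` {y \<in> I. P y x} \<subseteq> {..<r x}"
      using mono by auto
    show "card (r ` {y \<in> I. P y x}) = card {..<r x}"
      by (subst card_image) (auto simp: r_def intro: inj_on_subset[OF inj])
  qed simp
  have "r ` I = UNIV"
  proof (intro equalityI subsetI UNIV_I)
    fix m :: nat
    have "infinite (r ` I)"
      using inf inj by (simp add: finite_image_iff)
    then obtain x where "x \<in> I" "m < r x"
      by (metis (no_types, lifting) finite_nat_set_iff_bounded_le imageE not_le)
    then show "m \<in> r ` I"
      using initial[of x] by blast
  qed
  with inj have bij: "bij_betw r I UNIV"
    by (simp add: bij_betw_def)
  define e where "e = inv_into I r \<circ> (\<lambda>k. k - 1)"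
  have "bij_betw (\<lambda>k::nat. k - 1) {1..} UNIV"
    by (rule bij_betwI[where g = Suc]) auto
  then have e: "bij_betw e {1..} I"
    unfolding e_def using bij_betw_inv_into[OF bij] by (rule bij_betw_trans)
  have re: "r (e k) = k - 1" for k
    unfolding e_def using bij by (simp add: bij_betw_inv_into_right)
  have "mono_on {1..} (\<lambda>k. f (e k))"
  proof (rule mono_onI, rule ccontr)
    fix k l :: nat
    assume kl: "k \<in> {1..}" "l \<in> {1..}" "k \<le> l" "\<not> f (e k) \<le> f (e l)"
    then have "P (e l) (e k)" "e l \<in> I"
      using e by (auto simp: P_def bij_betw_def)
    with mono have "r (e l) < r (e k)"
      by blast
    with kl re show False
      by simp
  qed
  with e show ?thesis
    by (auto simp: nondecreasing_listing_def)
qed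

lemma finite_modes_below:
  assumes "\<forall>j\<in>{1..n}. 0 < a j"
  shows "finite {i \<in> modes n. mode_value n a i \<le> x}"
proof (rule finite_subset)
  show "finite (\<Pi>\<^sub>E j\<in>{1..n}. {..nat \<lceil>x * (a j)\<^sup>2 / pi\<^sup>2\<rceil>})"
    by (intro finite_PiE) auto
  show "{i \<in> modes n. mode_value n a i \<le> x} \<subseteq>
          (\<Pi>\<^sub>E j\<in>{1..n}. {..nat \<lceil>x * (a j)\<^sup>2 / pi\<^sup>2\<rceil>})"
  proof clarify
    fix i assume i: "i \<in> modes n" "mode_value n a i \<le> x"
    have "i j \<le> nat \<lceil>x * (a j)\<^sup>2 / pi\<^sup>2\<rceil>" if j: "j \<in> {1..n}" for j
    proof -
      have "pi\<^sup>2 * (real (i j))\<^sup>2 / (a j)\<^sup>2 \<le> mode_value n a i"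
        unfolding mode_value_def by (rule member_le_sum[OF j]) auto
      with i have "pi\<^sup>2 * (real (i j))\<^sup>2 / (a j)\<^sup>2 \<le> x"
        by linarith
      moreover have "0 < a j"
        using assms j by blast
      ultimately have "(real (i j))\<^sup>2 \<le> x * (a j)\<^sup>2 / pi\<^sup>2"
        by (simp add: field_simps)
      moreover have "real (i j) \<le> (real (i j))\<^sup>2"
        by (cases "i j") (auto simp: power2_eq_square)
      ultimately have "real (i j) \<le> x * (a j)\<^sup>2 / pi\<^sup>2"
        by linarith
      then show ?thesis
        by linarith
    qed
    with i show "i \<in> (\<Pi>\<^sub>E j\<in>{1..n}. {..nat \<lceil>x * (a j)\<^sup>2 / pi\<^sup>2\<rceil>})"
      by (auto simp: modes_def PiE_iff)
  qed
qed

lemma dirichlet_listing_exists: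
  assumes "1 \<le> n" and "\<forall>j\<in>{1..n}. 0 < a j"
  shows "\<exists>e. nondecreasing_listing (modes n) (mode_value n a) e"
proof (rule nondecreasing_listing_exists)
  have "inj_on (\<lambda>m. \<lambda>j\<in>{1..n}. m) {1::nat..}"
    using assms(1) by (auto simp: inj_on_def dest!: fun_cong[where x = 1])
  moreover have "(\<lambda>m. \<lambda>j\<in>{1..n}. m) ` {1::nat..} \<subseteq> modes n"
    by (auto simp: modes_def)
  ultimately show "infinite (modes n)"
    using infinite_Ici[of "1::nat"] finite_imageD finite_subset by metis
  show "finite {i \<in> modes n. mode_value n a i \<le> x}" for x
    using assms(2) by (rule finite_modes_below)
qed

lemma nondecreasing_listing_le:
  assumes e: "nondecreasing_listing I f e" and e': "nondecreasing_listing I f e'"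
    and k: "1 \<le> k"
  shows "f (e k) \<le> f (e' k)"
proof (rule ccontr)
  assume less: "\<not> f (e k) \<le> f (e' k)"
  have "e' ` {1..k} \<subseteq> e ` {1..<k}"
  proof
    fix y assume "y \<in> e' ` {1..k}"
    then obtain l where l: "1 \<le> l" "l \<le> k" "y = e' l"
      by auto
    with e' have "f y \<le> f (e' k)"
      using k by (auto simp: nondecreasing_listing_def dest: mono_onD[where r = l and s = k])
    moreover obtain m where m: "1 \<le> m" "y = e m"
      using e e' l unfolding nondecreasing_listing_def bij_betw_def
      by (metis atLeast_iff imageE imageI)
    moreover have "f (e k) \<le> f (e m)" if "k \<le> m"
      using e k m that by (auto simp: nondecreasing_listing_def dest: mono_onD[where r = k and s = m])
    ultimately show "y \<in> e ` {1..<k}"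
      using less by force
  qed
  then have "card (e' ` {1..k}) \<le> card (e ` {1..<k})"
    by (intro card_mono) auto
  moreover have "card (e' ` {1..k}) = k"
    using e' by (subst card_image)
      (auto simp: nondecreasing_listing_def bij_betw_def intro: inj_on_subset)
  moreover have "card (e ` {1..<k}) \<le> k - 1"
    using card_image_le[of "{1..<k}" e] by simp
  ultimately show False
    using k by linarith
qed

lemma dirichlet_eigenvalue_eq:
  assumes "nondecreasing_listing (modes n) (mode_value n a) e" and "1 \<le> k"
  shows "dirichlet_eigenvalue n a k = mode_value n a (e k)"
proof -
  have some: "nondecreasing_listing (modes n) (mode_value n a)
      (SOME e. nondecreasing_listing (modes n) (mode_value n a) e)"
    using someI_ex[of "nondecreasing_listing (modes n) (mode_value n a)"] assms(1) by blast
  show ?thesis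
    unfolding dirichlet_eigenvalue_def
    using nondecreasing_listing_le[OF some assms] nondecreasing_listing_le[OF assms(1) some assms(2)]
    by (rule antisym)
qed

end

theory Submission
  imports Defs
begin

text \<open>
  Write \<open>P(a, \<mu>) = \<Sum>\<^sub>i (\<mu> - \<Sum>\<^sub>j i\<^sub>j\<^sup>2 / a\<^sub>j\<^sup>2)\<^sub>+\<close>, the sum running over positive integer vectors. Since
  \<open>k \<Lambda> - \<Sum>\<^sub>i\<^sub>\<le>\<^sub>k \<lambda>\<^sub>i \<le> \<Sum>\<^sub>i (\<Lambda> - \<lambda>\<^sub>i)\<^sub>+\<close> for every \<open>\<Lambda>\<close>, with equality at \<open>\<Lambda> = \<lambda>\<^sub>k\<close>, taking \<open>\<pi>\<^sup>2 \<mu>\<close>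
  to be the \<open>k\<close>-th eigenvalue of the unit cube shows that a minimiser \<open>a\<close> satisfies
  \<open>P(cube, \<mu>) \<le> P(a, \<mu>)\<close>, where \<open>\<mu> \<ge> k\<^bsup>2/n\<^esup>\<close>.

  Summing one coordinate at a time gives \<open>P(a, \<mu>) = \<beta> \<mu>\<^bsup>n/2+1\<^esup> + O(\<mu>\<^bsup>(n+1)/2\<^esup>)\<close> for bounded sides
  and, for every cuboid, \<open>P(a, \<mu>) \<le> \<beta> \<mu>\<^bsup>n/2+1\<^esup> - c \<mu>\<^bsup>(n+1)/2\<^esup> / a\<^sub>j\<close> unless \<open>P(a, \<mu>) = 0\<close>. So
  the sides of minimisers stay in a compact subset of \<open>(0, \<infinity>)\<close>.

  On such a set the sum over all of \<open>\<int>\<^sup>n\<close> is the integral of the lattice point count, hence it varies with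
  \<open>a\<close> by at most \<open>O(\<mu>\<^bsup>\<theta>/2+1\<^esup>)\<close>. Up to \<open>O(\<mu>\<^bsup>n/2\<^esup>)\<close> it equals \<open>2\<^sup>n P(a, \<mu>)\<close> plus the contributions of the
  coordinate hyperplanes, which are proportional to \<open>\<mu>\<^bsup>(n+1)/2\<^esup> / a\<^sub>j\<close>; and \<open>\<theta> \<ge> n - 2\<close> makes that error
  harmless. Therefore \<open>\<Sum>\<^sub>j (1 / a\<^sub>j - 1) = O(\<mu>\<^bsup>(\<theta> - (n - 1))/2\<^esup>)\<close>, and as the \<open>a\<^sub>j\<close> have
  product \<open>1\<close>, the left-hand side dominates a multiple of \<open>(a\<^sub>n - 1)\<^sup>2\<close>.
\<close>

section \<open>One-dimensional sums\<close>

text \<open>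
  Sampling also at half-integers retains the drops \<open>h (i - 1/2) - h i\<close>, whose sum yields the negative
  second-order term of \<open>sum_slice_le_gain\<close>.
\<close>
lemma half_step_sum_le_integral:
  fixes h :: "real \<Rightarrow> real"
  assumes "antimono_on {0..} h" and "continuous_on {0..} h"
  shows "(\<Sum>i=1..M. (h (real i - 1/2) + h (real i)) / 2) \<le> integral {0..real M} h"
proof (induction M)
  case (Suc M)
  have int: "h integrable_on {x..y}" if "0 \<le> x" for x y
    using that by (intro integrable_continuous_interval continuous_on_subset[OF assms(2)]) auto
  have piece: "(y - x) * h y \<le> integral {x..y} h" if "0 \<le> x" "x \<le> y" for x y
  proof -
    have "integral {x..y} (\<lambda>_. h y) \<le> integral {x..y} h"
      using that by (intro integral_le int) (auto intro: monotone_onD[OF assms(1)])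
    with that show ?thesis by simp
  qed
  let ?m = "real M + 1/2"
  have "integral {0..real (Suc M)} h =
      integral {0..real M} h + (integral {real M..?m} h + integral {?m..real (Suc M)} h)"
    by (subst Henstock_Kurzweil_Integration.integral_combine, auto intro: int)+
  moreover have "h ?m / 2 \<le> integral {real M..?m} h" "h (real (Suc M)) / 2 \<le> integral {?m..real (Suc M)} h"
    using piece[of "real M" ?m] piece[of ?m "real (Suc M)"] by simp_all
  moreover have "real (Suc M) - 1/2 = ?m" by simp
  ultimately show ?case
    using Suc.IH by (simp only: sum.cl_ivl_Suc add_divide_distrib) simp
qed simp

lemma integral_le_sum:
  fixes h :: "real \<Rightarrow> real"
  assumes "antimono_on {0..} h" and "continuous_on {0..} h"
  shows "integral {0..real M} h \<le> (\<Sum>i<M. h (real i))"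
proof (induction M)
  case (Suc M)
  have int: "h integrable_on {x..y}" if "0 \<le> x" for x y
    using that by (intro integrable_continuous_interval continuous_on_subset[OF assms(2)]) auto
  have "integral {real M..real (Suc M)} h \<le> integral {real M..real (Suc M)} (\<lambda>_. h (real M))"
    by (intro integral_le int) (auto intro: monotone_onD[OF assms(1)])
  moreover have "integral {0..real (Suc M)} h = integral {0..real M} h + integral {real M..real (Suc M)} h"
    by (subst Henstock_Kurzweil_Integration.integral_combine) (auto intro: int)
  ultimately show ?case using Suc.IH by simp
qed simp

text \<open>For \<open>0 < q\<close> this is half of the Beta value
  \<open>B(1/2, q + 1)\<close>.\<close>

definition slice_integral :: "real \<Rightarrow> real" where
  "slice_integral q = integral {0..1} (\<lambda>x. max 0 (1 - x\<^sup>2) powr q)"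

text \<open>With \<open>A = a * sqrt \<mu>\<close> this is the profile of a layer sum along one
  axis, rescaled to height 1 (see \<open>slice_scale\<close>); on \<open>{0..}\<close> its support
  ends at \<open>A\<close>.\<close>

definition slice :: "real \<Rightarrow> real \<Rightarrow> real \<Rightarrow> real" where
  "slice q A x = max 0 (1 - x\<^sup>2 / A\<^sup>2) powr q"

lemma continuous_slice: "0 < q \<Longrightarrow> A \<noteq> 0 \<Longrightarrow> continuous_on X (slice q A)"
  unfolding slice_def by (intro continuous_on_powr' continuous_intros) auto

lemma antimono_slice: "0 < q \<Longrightarrow> antimono_on {0..} (slice q A)"
  unfolding slice_def
  by (intro monotone_onI powr_mono2 max.mono diff_left_mono divide_right_mono power_mono) auto

lemma slice_eq_0: "0 < A \<Longrightarrow> A \<le> x \<Longrightarrow> slice q A x = 0"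
  unfolding slice_def by (simp add: max_def field_simps power_mono)

lemma integral_slice:
  assumes "0 < q" "0 < A" "A \<le> L"
  shows "integral {0..L} (slice q A) = A * slice_integral q"
proof -
  have int: "slice q A integrable_on {x..y}" for x y
    using assms by (intro integrable_continuous_interval continuous_slice) auto
  have "integral {0..L} (slice q A) = integral {0..A} (slice q A) + integral {A..L} (slice q A)"
    using assms by (intro Henstock_Kurzweil_Integration.integral_combine[symmetric] int) auto
  moreover have "integral {A..L} (slice q A) = integral {A..L} (\<lambda>_. 0)"
    using assms by (intro integral_cong) (auto intro: slice_eq_0)
  moreover have "((\<lambda>x. slice q A (A *\<^sub>R x + 0)) has_integral integral {0..A} (slice q A) /\<^sub>R A)
      (cbox ((0 - 0) /\<^sub>R A) ((A - 0) /\<^sub>R A))"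
    using assms(2) integrable_integral[OF int[of 0 A]]
    by (intro has_integral_affinity'[of "slice q A" _ 0 A A 0, unfolded DIM_real power_one_right]) auto
  moreover have "slice q A (A *\<^sub>R x + 0) = max 0 (1 - x\<^sup>2) powr q" for x
    using assms(2) by (simp add: slice_def power_mult_distrib)
  ultimately show ?thesis
    using assms(2) by (auto simp: slice_integral_def dest!: integral_unique)
qed

lemma slice_integral_pos:
  assumes "0 < q"
  shows "0 < slice_integral q"
proof -
  have "(\<Sum>i=1..1. (slice q 1 (real i - 1/2) + slice q 1 (real i)) / 2) \<le> integral {0..real 1} (slice q 1)"
    using assms by (intro half_step_sum_le_integral antimono_slice continuous_slice) auto
  moreover have "0 < slice q 1 (1/2)" by (simp add: slice_def power2_eq_square)
  ultimately show ?thesis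
    using integral_slice[of q 1 1] assms by (simp add: slice_eq_0)
qed

lemma half_step_slice_le:
  assumes "0 < q" "0 < A"
  shows "(\<Sum>i=1..M. (slice q A (real i - 1/2) + slice q A (real i)) / 2) \<le> A * slice_integral q"
proof -
  \<comment> \<open>\<open>integral_slice\<close> needs an interval covering \<open>{0..A}\<close>,
    which \<open>M\<close> may fall short of.\<close>
  define M' where "M' = max M (nat \<lceil>A\<rceil>)"
  have "A \<le> real M'" unfolding M'_def by linarith
  have "(\<Sum>i=1..M. (slice q A (real i - 1/2) + slice q A (real i)) / 2)
      \<le> (\<Sum>i=1..M'. (slice q A (real i - 1/2) + slice q A (real i)) / 2)"
    by (intro sum_mono2) (auto simp: M'_def slice_def)
  also have "\<dots> \<le> integral {0..real M'} (slice q A)"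
    using assms by (intro half_step_sum_le_integral antimono_slice continuous_slice) auto
  also have "\<dots> = A * slice_integral q"
    using assms \<open>A \<le> real M'\<close> by (rule integral_slice)
  finally show ?thesis .
qed

lemma slice_half_step_ge: "0 < q \<Longrightarrow> 1 \<le> i \<Longrightarrow> slice q A (real i) \<le> slice q A (real i - 1/2)"
  by (rule monotone_onD[OF antimono_slice]) auto

lemma sum_slice_le:
  assumes "0 < q" "0 < A"
  shows "(\<Sum>i=1..M. slice q A (real i)) \<le> A * slice_integral q"
proof -
  have "(\<Sum>i=1..M. slice q A (real i)) \<le> (\<Sum>i=1..M. (slice q A (real i - 1/2) + slice q A (real i)) / 2)"
    using slice_half_step_ge[OF assms(1)] by (intro sum_mono) auto
  with half_step_slice_le[OF assms, of M] show ?thesis by simp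
qed

text \<open>Left endpoints overestimate the integral of a decreasing function; starting at index 1
  instead of 0 costs the term at 0, which is 1.\<close>

lemma sum_slice_ge:
  assumes "0 < q" "0 < A" "A \<le> real M"
  shows "A * slice_integral q - 1 \<le> (\<Sum>i=1..M. slice q A (real i))"
proof -
  have "A * slice_integral q = integral {0..real M} (slice q A)"
    using assms by (simp add: integral_slice)
  also have "\<dots> \<le> (\<Sum>i<M. slice q A (real i))"
    using assms by (intro integral_le_sum antimono_slice continuous_slice) auto
  also have "\<dots> \<le> (\<Sum>i\<in>insert 0 {1..M}. slice q A (real i))"
    by (intro sum_mono2) (auto simp: slice_def)
  finally show ?thesis by (simp add: slice_def)
qed

text \<open>The gain is uniform in \<open>A\<close>: about \<open>A / 2\<close> indices have drops
  of order \<open>i / A\<^sup>2\<close>, which add up to a positive constant. Half of it survives in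
  the averages of \<open>half_step_slice_le\<close>.\<close>

lemma sum_slice_le_gain:
  assumes "1 \<le> q" "1 \<le> A"
  shows "(\<Sum>i=1..M. slice q A (real i)) \<le> A * slice_integral q - (3/4) powr (q - 1) / 64"
proof -
  \<comment> \<open>Only the drops with \<open>i \<le> m\<close> are kept: there \<open>(i - 1/2)\<^sup>2 / A\<^sup>2 \<le> 1/4\<close> and \<open>i \<le> A\<close>.\<close>
  define m where "m = nat \<lfloor>A / 2 + 1/2\<rfloor>"
  have m: "1 \<le> m" "A / 2 - 1/2 < real m" "real m \<le> A / 2 + 1/2"
    unfolding m_def using assms(2) by linarith+
  then have "A / 4 \<le> real m" by linarith
  have drop: "(3/4) powr (q - 1) * ((real i - 1/4) / A\<^sup>2) \<le> slice q A (real i - 1/2) - slice q A (real i)"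
    if i: "i \<in> {1..m}" for i
  proof -
    define u w where "u = 1 - (real i - 1/2)\<^sup>2 / A\<^sup>2" and "w = 1 - (real i)\<^sup>2 / A\<^sup>2"
    have "(real i - 1/2)\<^sup>2 \<le> (A / 2)\<^sup>2" "(real i)\<^sup>2 \<le> A\<^sup>2"
      using i m assms(2) by (intro power_mono; simp)+
    then have "3/4 \<le> u" "0 \<le> w"
      using assms(2) by (auto simp: u_def w_def field_simps)
    have uw: "u - w = (real i - 1/4) / A\<^sup>2"
      by (simp add: u_def w_def power2_eq_square diff_divide_distrib[symmetric] algebra_simps)
    have "1/4 \<le> real i" using i by simp
    then have "w \<le> u" using uw by (smt (verit) divide_nonneg_nonneg zero_le_power2)
    \<comment> \<open>As \<open>q \<ge> 1\<close>, replacing \<open>w powr (q - 1)\<close> by the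
      larger \<open>u powr (q - 1)\<close> bounds \<open>u powr q - w powr q\<close> below by
      \<open>u powr (q - 1) * (u - w)\<close>.\<close>
    have "(3/4) powr (q - 1) * (u - w) \<le> u powr (q - 1) * (u - w)"
      using \<open>3/4 \<le> u\<close> \<open>w \<le> u\<close> assms by (intro mult_right_mono powr_mono2) auto
    also have "\<dots> \<le> u powr (q - 1) * u - w powr (q - 1) * w"
      using mult_right_mono[OF powr_mono2[OF _ \<open>0 \<le> w\<close> \<open>w \<le> u\<close>, of "q - 1"] \<open>0 \<le> w\<close>] assms(1)
      by (simp add: algebra_simps)
    also have "\<dots> = u powr q - w powr q"
      using \<open>3/4 \<le> u\<close> \<open>0 \<le> w\<close> assms(1) powr_mult_base[of u "q - 1"] powr_mult_base[of w "q - 1"]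
      by (simp add: mult.commute)
    finally show ?thesis
      unfolding slice_def u_def[symmetric] w_def[symmetric] uw[symmetric]
      using \<open>3/4 \<le> u\<close> \<open>0 \<le> w\<close> by (simp add: max_absorb2)
  qed
  have sum_i: "(\<Sum>i=1..m. real i - 1/4) = (real m)\<^sup>2 / 2 + real m / 4" for m
    by (induction m) (auto simp: power2_eq_square field_simps)
  \<comment> \<open>From \<open>A / 4 \<le> real m\<close>, the numerator is at least
    \<open>(A / 4)\<^sup>2 / 2\<close>.\<close>
  have "1 / 32 \<le> (\<Sum>i=1..m. real i - 1/4) / A\<^sup>2"
  proof -
    have "(A / 4)\<^sup>2 \<le> (real m)\<^sup>2"
      using \<open>A / 4 \<le> real m\<close> assms(2) by (intro power_mono) auto
    then show ?thesis
      unfolding sum_i using assms(2) by (simp add: field_simps)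
  qed
  then have "(3/4) powr (q - 1) / 32 \<le> (3/4) powr (q - 1) * ((\<Sum>i=1..m. real i - 1/4) / A\<^sup>2)"
    by (metis mult.right_neutral mult_left_mono powr_ge_zero times_divide_eq_right)
  also have "\<dots> \<le> (\<Sum>i=1..m. slice q A (real i - 1/2) - slice q A (real i))"
    unfolding sum_divide_distrib sum_distrib_left by (intro sum_mono drop)
  \<comment> \<open>\<open>M\<close> may be smaller than \<open>m\<close>, so the comparison runs
    over the longer range; the extra drops are nonnegative.\<close>
  also have "\<dots> \<le> (\<Sum>i=1..max m M. slice q A (real i - 1/2) - slice q A (real i))"
    using slice_half_step_ge[of q _ A] assms(1) by (intro sum_mono2) (auto simp: order.trans)
  finally have gain: "(3/4) powr (q - 1) / 32 \<le> \<dots>" .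
  have "(\<Sum>i=1..M. slice q A (real i)) \<le> (\<Sum>i=1..max m M. slice q A (real i))"
    by (intro sum_mono2) (auto simp: slice_def)
  moreover have "(\<Sum>i=1..max m M. (slice q A (real i - 1/2) + slice q A (real i)) / 2) =
      (\<Sum>i=1..max m M. slice q A (real i)) +
      (\<Sum>i=1..max m M. slice q A (real i - 1/2) - slice q A (real i)) / 2"
    by (simp add: sum.distrib sum_subtractf add_divide_distrib diff_divide_distrib sum_divide_distrib[symmetric])
  ultimately show ?thesis
    using gain half_step_slice_le[of q A "max m M"] assms by simp
qed

section \<open>Riesz means over boxes of positive integers\<close>

text \<open>
  The infinite Riesz mean is truncated to a finite box \<open>A\<^bsup>J\<^esup>\<close>, with \<open>A = {1..M}\<close> or \<open>A = {- M..M}\<close>; the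
  terms vanish outside the box once \<open>M \<ge> a j * sqrt \<mu>\<close> for all \<open>j\<close>.
\<close>
definition riesz_sum :: "int set \<Rightarrow> nat set \<Rightarrow> (nat \<Rightarrow> real) \<Rightarrow> real \<Rightarrow> real" where
  "riesz_sum A J a \<mu> =
     (\<Sum>z\<in>J \<rightarrow>\<^sub>E A. max 0 (\<mu> - (\<Sum>j\<in>J. (real_of_int (z j))\<^sup>2 / (a j)\<^sup>2)))"

lemma riesz_sum_nonneg: "0 \<le> riesz_sum A J a \<mu>"
  unfolding riesz_sum_def by (intro sum_nonneg) auto

lemma riesz_sum_empty [simp]: "riesz_sum A {} a \<mu> = max 0 \<mu>"
  by (simp add: riesz_sum_def)

lemma riesz_sum_insert:
  assumes "finite J" "j \<notin> J"
  shows "riesz_sum A (insert j J) a \<mu> =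
    (\<Sum>i\<in>A. riesz_sum A J a (\<mu> - (real_of_int i)\<^sup>2 / (a j)\<^sup>2))"
proof -
  have "(\<Sum>l\<in>J. (real_of_int ((z(j := i)) l))\<^sup>2 / (a l)\<^sup>2) = (\<Sum>l\<in>J. (real_of_int (z l))\<^sup>2 / (a l)\<^sup>2)" for i z
    using assms by (intro sum.cong) auto
  then show ?thesis
    unfolding riesz_sum_def PiE_insert_eq sum.reindex[OF inj_combinator[OF assms(2), of "\<lambda>_. A"]]
    using assms
    by (simp add: sum.cartesian_product case_prod_unfold algebra_simps del: fun_upd_apply add: fun_upd_same)
qed

text \<open>The integral of \<open>max 0 (1 - |x|\<^sup>2)\<close> over the positive orthant of
  dimension \<open>m\<close>, that is \<open>unit_ball_vol m / (2 ^ m * (m / 2 + 1))\<close>.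
  Integrating out one coordinate raises the exponent by 1/2, whence the exponents 1, 3/2, 2, ... in
  the product.\<close>

definition slice_const :: "nat \<Rightarrow> real" where
  "slice_const m = (\<Prod>i<m. slice_integral (1 + real i / 2))"

lemma slice_const_pos: "0 < slice_const m"
  unfolding slice_const_def by (intro prod_pos) (auto intro!: slice_integral_pos)

lemma slice_const_Suc: "slice_const (Suc m) = slice_const m * slice_integral (1 + real m / 2)"
  by (simp add: slice_const_def)

lemma sum_int_atLeast1: "(\<Sum>i\<in>{1..int M}. f i) = (\<Sum>i=1..M. f (int i))"
proof -
  have "{1..int M} = int ` {1..M}" by (simp add: image_int_atLeastAtMost)
  then show ?thesis by (simp add: sum.reindex)
qed

lemma slice_scale:
  assumes "0 < \<mu>" "0 < a"
  shows "max 0 (\<mu> - x\<^sup>2 / a\<^sup>2) powr q = \<mu> powr q * slice q (a * sqrt \<mu>) x"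
proof -
  have "max 0 (\<mu> - x\<^sup>2 / a\<^sup>2) = \<mu> * max 0 (1 - x\<^sup>2 / (a * sqrt \<mu>)\<^sup>2)"
  proof -
    have "\<mu> - x\<^sup>2 / a\<^sup>2 = \<mu> * (1 - x\<^sup>2 / (a * sqrt \<mu>)\<^sup>2)"
      using assms by (simp add: power_mult_distrib field_simps)
    with assms show ?thesis by (simp only: max_mult_distrib_left) simp
  qed
  with assms show ?thesis by (simp add: slice_def powr_mult)
qed

lemma powr_half_sqrt_mult: "0 < \<mu> \<Longrightarrow> \<mu> powr (q + 1/2) = \<mu> powr q * sqrt \<mu>"
  by (simp add: powr_add powr_half_sqrt)

lemma sum_layer_le:
  assumes "0 < q" "0 < a"
  shows "(\<Sum>i\<in>{1..int M}. max 0 (\<mu> - (real_of_int i)\<^sup>2 / a\<^sup>2) powr q)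
    \<le> a * slice_integral q * max 0 \<mu> powr (q + 1/2)"
proof (cases "0 < \<mu>")
  case True
  with assms sum_slice_le[of q "a * sqrt \<mu>" M] show ?thesis
    by (simp add: sum_int_atLeast1 slice_scale powr_half_sqrt_mult mult_ac flip: sum_distrib_left)
next
  case False
  then have "max 0 (\<mu> - x\<^sup>2 / a\<^sup>2) = 0" for x
    by (simp add: max_def) (smt (verit) divide_nonneg_nonneg zero_le_power2)
  with False show ?thesis by simp
qed

lemma sum_layer_ge:
  assumes "0 < q" "0 < a" "a * sqrt \<mu> \<le> real M"
  shows "a * slice_integral q * max 0 \<mu> powr (q + 1/2) - max 0 \<mu> powr q
    \<le> (\<Sum>i\<in>{1..int M}. max 0 (\<mu> - (real_of_int i)\<^sup>2 / a\<^sup>2) powr q)"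
proof (cases "0 < \<mu>")
  case True
  then have "\<mu> powr q * (a * sqrt \<mu> * slice_integral q - 1) \<le>
      \<mu> powr q * (\<Sum>i=1..M. slice q (a * sqrt \<mu>) (real i))"
    using assms by (intro mult_left_mono sum_slice_ge) auto
  with True assms show ?thesis
    by (simp add: sum_int_atLeast1 slice_scale powr_half_sqrt_mult algebra_simps flip: sum_distrib_left)
qed (auto intro!: sum_nonneg)

lemma sum_layer_le_gain:
  assumes "1 \<le> q" "0 < a" "0 < \<mu>" "1 \<le> a * sqrt \<mu>"
  shows "(\<Sum>i\<in>{1..int M}. max 0 (\<mu> - (real_of_int i)\<^sup>2 / a\<^sup>2) powr q)
    \<le> a * slice_integral q * \<mu> powr (q + 1/2) - (3/4) powr (q - 1) / 64 * \<mu> powr q"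
proof -
  have "\<mu> powr q * (\<Sum>i=1..M. slice q (a * sqrt \<mu>) (real i)) \<le>
      \<mu> powr q * (a * sqrt \<mu> * slice_integral q - (3/4) powr (q - 1) / 64)"
    using assms by (intro mult_left_mono sum_slice_le_gain) auto
  with assms show ?thesis
    by (simp add: sum_int_atLeast1 slice_scale powr_half_sqrt_mult algebra_simps flip: sum_distrib_left)
qed

text \<open>Splitting off a coordinate leaves Riesz sums at lowered parameters, which the induction
  hypothesis bounds and \<open>sum_layer_le\<close> adds up. The lowered parameters may be negative,
  hence \<open>max 0 \<mu>\<close>.\<close>

lemma riesz_sum_le:
  assumes "finite J" "\<And>j. j \<in> J \<Longrightarrow> 0 < a j"
  shows "riesz_sum {1..int M} J a \<mu> \<le>
    slice_const (card J) * (\<Prod>j\<in>J. a j) * max 0 \<mu> powr (1 + real (card J) / 2)"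
  using assms
proof (induction J arbitrary: \<mu>)
  case (insert j J)
  let ?q = "1 + real (card J) / 2"
  have "riesz_sum {1..int M} (insert j J) a \<mu> \<le>
      (\<Sum>i\<in>{1..int M}. slice_const (card J) * (\<Prod>j\<in>J. a j) * max 0 (\<mu> - (real_of_int i)\<^sup>2 / (a j)\<^sup>2) powr ?q)"
    unfolding riesz_sum_insert[OF insert.hyps] by (intro sum_mono insert.IH insert.prems) auto
  also have "\<dots> \<le> slice_const (card J) * (\<Prod>j\<in>J. a j) * (a j * slice_integral ?q * max 0 \<mu> powr (?q + 1/2))"
    unfolding sum_distrib_left[symmetric]
    using insert.prems by (intro mult_left_mono sum_layer_le) (auto intro!: mult_nonneg_nonneg prod_nonneg
        simp: less_imp_le slice_const_pos)
  finally show ?case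
    using insert.hyps by (simp add: slice_const_Suc mult_ac add_ac add_divide_distrib)
qed (simp add: slice_const_def)

text \<open>The same induction from below, now with an error half a power of \<open>\<mu>\<close>
  under the main term. The constant depends only on \<open>L\<close> and \<open>J\<close>, so it is
  uniform over all sides up to \<open>L\<close>.\<close>

lemma riesz_sum_ge:
  assumes "finite J"
  shows "\<exists>C. \<forall>a \<mu> M. (\<forall>j\<in>J. 0 < a j \<and> a j \<le> L) \<and> L * sqrt \<mu> \<le> real M \<longrightarrow>
    slice_const (card J) * (\<Prod>j\<in>J. a j) * max 0 \<mu> powr (1 + real (card J) / 2)
      - C * max 0 \<mu> powr ((1 + real (card J)) / 2) \<le> riesz_sum {1..int M} J a \<mu>"
  using assms
proof (induction J)
  case empty
  show ?case by (intro exI[of _ 0]) (simp add: slice_const_def)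
next
  case (insert j J)
  then obtain C where C: "\<And>a \<mu> M. (\<forall>j\<in>J. 0 < a j \<and> a j \<le> L) \<Longrightarrow> L * sqrt \<mu> \<le> real M \<Longrightarrow>
    slice_const (card J) * (\<Prod>j\<in>J. a j) * max 0 \<mu> powr (1 + real (card J) / 2)
      - C * max 0 \<mu> powr ((1 + real (card J)) / 2) \<le> riesz_sum {1..int M} J a \<mu>"
    by blast
  let ?q = "1 + real (card J) / 2" and ?r = "(1 + real (card J)) / 2"
  \<comment> \<open>The first summand is the loss of \<open>sum_layer_ge\<close> at the new
    coordinate; the second is the old error summed over the layers, which raises its exponent from
    \<open>?r\<close> to \<open>?q\<close>.\<close>
  define D where "D = slice_const (card J) * L ^ card J + \<bar>C\<bar> * L * slice_integral ?r"
  show ?case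
  proof (intro exI[of _ D] allI impI, elim conjE)
    fix a \<mu> M
    assume a: "\<forall>j\<in>insert j J. 0 < a j \<and> a j \<le> L" and M: "L * sqrt \<mu> \<le> real M"
    then have "0 < L" by fastforce
    let ?b = "slice_const (card J) * (\<Prod>j\<in>J. a j)"
    let ?P = "max 0 \<mu>"
    have b: "0 \<le> ?b" "?b \<le> slice_const (card J) * L ^ card J"
    proof -
      show "0 \<le> ?b" using a slice_const_pos[of "card J"] by (intro mult_nonneg_nonneg prod_nonneg) (auto simp: less_imp_le)
      have "(\<Prod>j\<in>J. a j) \<le> (\<Prod>j\<in>J. L)" using a by (intro prod_mono) (auto simp: less_imp_le)
      then show "?b \<le> slice_const (card J) * L ^ card J"
        using slice_const_pos[of "card J"] by simp
    qed
    \<comment> \<open>The summed old error is estimated from above, which requires a nonnegative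
      coefficient: hence \<open>\<bar>C\<bar>\<close>.\<close>
    have "?b * (a j * slice_integral ?q * ?P powr (?q + 1/2) - ?P powr ?q) - \<bar>C\<bar> * (a j * slice_integral ?r * ?P powr (?r + 1/2))
        \<le> ?b * (\<Sum>i\<in>{1..int M}. max 0 (\<mu> - (real_of_int i)\<^sup>2 / (a j)\<^sup>2) powr ?q)
          - \<bar>C\<bar> * (\<Sum>i\<in>{1..int M}. max 0 (\<mu> - (real_of_int i)\<^sup>2 / (a j)\<^sup>2) powr ?r)"
    proof (intro diff_mono mult_left_mono sum_layer_ge sum_layer_le b)
      have "a j * sqrt \<mu> \<le> L * sqrt \<mu>" if "0 \<le> \<mu>" using a that by (intro mult_right_mono) auto
      \<comment> \<open>The square root of a negative number is negative here.\<close>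
      moreover have "a j * sqrt \<mu> \<le> 0" if "\<mu> < 0" using a that by (simp add: mult_nonneg_nonpos less_imp_le)
      ultimately show "a j * sqrt \<mu> \<le> real M" using M by (smt (verit) of_nat_0_le_iff)
    qed (use a in auto)
    also have "\<dots> = (\<Sum>i\<in>{1..int M}. ?b * max 0 (\<mu> - (real_of_int i)\<^sup>2 / (a j)\<^sup>2) powr ?q
          - \<bar>C\<bar> * max 0 (\<mu> - (real_of_int i)\<^sup>2 / (a j)\<^sup>2) powr ?r)"
      by (simp add: sum_distrib_left sum_subtractf)
    also have "\<dots> \<le> (\<Sum>i\<in>{1..int M}. riesz_sum {1..int M} J a (\<mu> - (real_of_int i)\<^sup>2 / (a j)\<^sup>2))"
    proof (intro sum_mono)
      fix i
      have "L * sqrt (\<mu> - (real_of_int i)\<^sup>2 / (a j)\<^sup>2) \<le> L * sqrt \<mu>"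
        using \<open>0 < L\<close> by (intro mult_left_mono) auto
      with M have "L * sqrt (\<mu> - (real_of_int i)\<^sup>2 / (a j)\<^sup>2) \<le> real M" by linarith
      then have "?b * max 0 (\<mu> - (real_of_int i)\<^sup>2 / (a j)\<^sup>2) powr ?q
          - C * max 0 (\<mu> - (real_of_int i)\<^sup>2 / (a j)\<^sup>2) powr ?r
          \<le> riesz_sum {1..int M} J a (\<mu> - (real_of_int i)\<^sup>2 / (a j)\<^sup>2)"
        using a by (intro C) auto
      moreover have "C * x powr ?r \<le> \<bar>C\<bar> * x powr ?r" for x
        by (intro mult_right_mono) auto
      ultimately show "?b * max 0 (\<mu> - (real_of_int i)\<^sup>2 / (a j)\<^sup>2) powr ?q
          - \<bar>C\<bar> * max 0 (\<mu> - (real_of_int i)\<^sup>2 / (a j)\<^sup>2) powr ?r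
          \<le> riesz_sum {1..int M} J a (\<mu> - (real_of_int i)\<^sup>2 / (a j)\<^sup>2)"
        by (smt (verit))
    qed
    also have "\<dots> = riesz_sum {1..int M} (insert j J) a \<mu>"
      by (rule riesz_sum_insert[OF insert.hyps, symmetric])
    finally have *: "?b * (a j * slice_integral ?q * ?P powr (?q + 1/2) - ?P powr ?q)
      - \<bar>C\<bar> * (a j * slice_integral ?r * ?P powr (?r + 1/2)) \<le> riesz_sum {1..int M} (insert j J) a \<mu>" .
    have r: "?r + 1/2 = ?q" by (simp add: add_divide_distrib)
    have "0 < slice_integral ?r" by (intro slice_integral_pos) simp
    then have "?b + \<bar>C\<bar> * (a j * slice_integral ?r) \<le> D"
      unfolding D_def mult.assoc using a
      by (intro add_mono[OF b(2)]) (auto intro!: mult_left_mono mult_right_mono)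
    then have "?b * ?P powr ?q + \<bar>C\<bar> * (a j * slice_integral ?r * ?P powr ?q) \<le> D * ?P powr ?q"
      by (metis (no_types, opaque_lifting) distrib_right mult.assoc mult_right_mono powr_ge_zero)
    with * have "?b * (a j * slice_integral ?q * ?P powr (?q + 1/2)) - D * ?P powr ?q
        \<le> riesz_sum {1..int M} (insert j J) a \<mu>"
      unfolding r by (simp add: algebra_simps)
    then show "slice_const (card (insert j J)) * (\<Prod>j\<in>insert j J. a j) * ?P powr (1 + real (card (insert j J)) / 2)
      - D * ?P powr ((1 + real (card (insert j J))) / 2) \<le> riesz_sum {1..int M} (insert j J) a \<mu>"
      using insert.hyps by (simp add: slice_const_Suc mult_ac add_ac add_divide_distrib)
  qed
qed

text \<open>The layers of coordinate \<open>j\<close> are summed last, with the sharper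
  \<open>sum_layer_le_gain\<close>. When \<open>insert j J\<close> indexes a unit cuboid, the
  product over \<open>J\<close> is \<open>1 / a j\<close>, so the gain grows as that side
  shrinks.\<close>

lemma riesz_sum_le_gain:
  assumes "finite J" "j \<notin> J" "\<And>i. i \<in> insert j J \<Longrightarrow> 0 < a i" "0 < \<mu>" "1 \<le> a j * sqrt \<mu>"
  shows "riesz_sum {1..int M} (insert j J) a \<mu> \<le>
    slice_const (Suc (card J)) * (\<Prod>i\<in>insert j J. a i) * \<mu> powr (1 + real (Suc (card J)) / 2)
    - slice_const (card J) * (\<Prod>i\<in>J. a i) * ((3/4) powr (real (card J) / 2) / 64)
        * \<mu> powr (1 + real (card J) / 2)"
proof -
  let ?q = "1 + real (card J) / 2"
  have "riesz_sum {1..int M} (insert j J) a \<mu> \<le>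
      (\<Sum>i\<in>{1..int M}. slice_const (card J) * (\<Prod>j\<in>J. a j) * max 0 (\<mu> - (real_of_int i)\<^sup>2 / (a j)\<^sup>2) powr ?q)"
    unfolding riesz_sum_insert[OF assms(1,2)] using assms by (intro sum_mono riesz_sum_le) auto
  also have "\<dots> \<le> slice_const (card J) * (\<Prod>j\<in>J. a j) *
      (a j * slice_integral ?q * \<mu> powr (?q + 1/2) - (3/4) powr (?q - 1) / 64 * \<mu> powr ?q)"
    unfolding sum_distrib_left[symmetric]
    using assms by (intro mult_left_mono sum_layer_le_gain) (auto intro!: mult_nonneg_nonneg prod_nonneg
        simp: less_imp_le slice_const_pos)
  finally show ?thesis
    using assms by (simp add: slice_const_Suc algebra_simps add_divide_distrib)
qed

text \<open>The case left open by \<open>riesz_sum_le_gain\<close>: already \<open>z j = 1\<close>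
  makes the \<open>j\<close>-th summand exceed \<open>\<mu>\<close>.\<close>

lemma riesz_sum_eq_0:
  assumes "finite J" "j \<in> J" "0 < a j" "a j * sqrt \<mu> < 1"
  shows "riesz_sum {1..int M} J a \<mu> = 0"
  unfolding riesz_sum_def
proof (intro sum.neutral ballI)
  fix z assume "z \<in> J \<rightarrow>\<^sub>E {1..int M}"
  with assms(2) have "1 \<le> z j" by auto
  have "sqrt \<mu> < 1 / a j" using assms(3,4) by (simp add: field_simps)
  then have "\<mu> < (1 / a j)\<^sup>2" using assms(3) by (metis less_imp_le not_less real_le_rsqrt zero_less_divide_1_iff real_sqrt_less_iff real_sqrt_unique)
  also have "\<dots> \<le> (real_of_int (z j))\<^sup>2 / (a j)\<^sup>2"
    using \<open>1 \<le> z j\<close> by (simp add: power_divide divide_right_mono)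
  also have "\<dots> \<le> (\<Sum>j\<in>J. (real_of_int (z j))\<^sup>2 / (a j)\<^sup>2)"
    using assms by (intro member_le_sum) auto
  finally show "max 0 (\<mu> - (\<Sum>j\<in>J. (real_of_int (z j))\<^sup>2 / (a j)\<^sup>2)) = 0" by simp
qed

section \<open>Comparing a minimiser with the cube\<close>

lemma sum_modes_box:
  "(\<Sum>i\<in>{1..n} \<rightarrow>\<^sub>E {1..M}. max 0 (\<Lambda> - mode_value n a i))
    = pi\<^sup>2 * riesz_sum {1..int M} {1..n} a (\<Lambda> / pi\<^sup>2)"
proof -
  have "max 0 (\<Lambda> - mode_value n a i) =
      pi\<^sup>2 * max 0 (\<Lambda> / pi\<^sup>2 - (\<Sum>j=1..n. (real (i j))\<^sup>2 / (a j)\<^sup>2))" for i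
  proof -
    have "\<Lambda> - mode_value n a i = pi\<^sup>2 * (\<Lambda> / pi\<^sup>2 - (\<Sum>j=1..n. (real (i j))\<^sup>2 / (a j)\<^sup>2))"
      by (simp add: mode_value_def right_diff_distrib sum_distrib_left)
    then show ?thesis by (simp only: max_mult_distrib_left) simp
  qed
  then have "(\<Sum>i\<in>{1..n} \<rightarrow>\<^sub>E {1..M}. max 0 (\<Lambda> - mode_value n a i)) =
      pi\<^sup>2 * (\<Sum>i\<in>{1..n} \<rightarrow>\<^sub>E {1..M}. max 0 (\<Lambda> / pi\<^sup>2 - (\<Sum>j=1..n. (real (i j))\<^sup>2 / (a j)\<^sup>2)))"
    by (simp add: sum_distrib_left)
  also have "(\<Sum>i\<in>{1..n} \<rightarrow>\<^sub>E {1..M}. max 0 (\<Lambda> / pi\<^sup>2 - (\<Sum>j=1..n. (real (i j))\<^sup>2 / (a j)\<^sup>2)))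
      = riesz_sum {1..int M} {1..n} a (\<Lambda> / pi\<^sup>2)"
    unfolding riesz_sum_def
    by (rule sum.reindex_bij_witness[where i = "\<lambda>z. \<lambda>j\<in>{1..n}. nat (z j)" and j = "\<lambda>i. \<lambda>j\<in>{1..n}. int (i j)"])
      (auto simp: PiE_iff extensional_def fun_eq_iff nat_le_iff intro!: sum.cong arg_cong[where f = "max 0"], force)
  finally show ?thesis .
qed

lemma finite_modes_box: "finite ({1..n::nat} \<rightarrow>\<^sub>E {1..M::nat})"
  by (intro finite_PiE) auto

text \<open>Passing to positive parts and adding further modes only increases the sum, once the box
  contains the first \<open>k\<close> modes. \<open>\<Lambda>\<close> is free, so an eigenvalue of a
  different cuboid may be inserted.\<close>

lemma eigenvalue_sum_ge:
  assumes "1 \<le> n" "1 \<le> k" "\<forall>j\<in>{1..n}. 0 < a j"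
  shows "\<exists>M0. \<forall>M\<ge>M0. real k * \<Lambda> - real k * eigenvalue_average n k a
    \<le> pi\<^sup>2 * riesz_sum {1..int M} {1..n} a (\<Lambda> / pi\<^sup>2)"
proof -
  obtain e where e: "nondecreasing_listing (modes n) (mode_value n a) e"
    using dirichlet_listing_exists assms by blast
  then have bij: "bij_betw e {1..} (modes n)" by (simp add: nondecreasing_listing_def)
  \<comment> \<open>The total of all coordinates of the first \<open>k\<close> modes bounds each
    single one.\<close>
  define M0 where "M0 = (\<Sum>x\<in>e ` {1..k}. \<Sum>j=1..n. x j)"
  have box: "e ` {1..k} \<subseteq> {1..n} \<rightarrow>\<^sub>E {1..M}" if "M0 \<le> M" for M
  proof
    fix x assume x: "x \<in> e ` {1..k}"
    then have "x \<in> modes n" using bij by (auto simp: bij_betw_def)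
    moreover have "x j \<le> M" if "j \<in> {1..n}" for j
    proof -
      have "x j \<le> (\<Sum>j=1..n. x j)" using that by (intro member_le_sum) auto
      also have "\<dots> \<le> M0" unfolding M0_def using x by (intro member_le_sum) auto
      finally show ?thesis using \<open>M0 \<le> M\<close> by simp
    qed
    ultimately show "x \<in> {1..n} \<rightarrow>\<^sub>E {1..M}" by (auto simp: modes_def PiE_iff)
  qed
  have "real k * \<Lambda> - real k * eigenvalue_average n k a = (\<Sum>i=1..k. \<Lambda> - mode_value n a (e i))"
    using assms(2) dirichlet_eigenvalue_eq[OF e] by (simp add: eigenvalue_average_def sum_subtractf)
  also have "\<dots> \<le> (\<Sum>i=1..k. max 0 (\<Lambda> - mode_value n a (e i)))"
    by (intro sum_mono) auto
  also have "\<dots> = (\<Sum>x\<in>e ` {1..k}. max 0 (\<Lambda> - mode_value n a x))"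
    using bij by (subst sum.reindex) (auto simp: bij_betw_def intro: inj_on_subset)
  finally have *: "real k * \<Lambda> - real k * eigenvalue_average n k a \<le> \<dots>" .
  have "real k * \<Lambda> - real k * eigenvalue_average n k a
    \<le> pi\<^sup>2 * riesz_sum {1..int M} {1..n} a (\<Lambda> / pi\<^sup>2)" if "M0 \<le> M" for M
    unfolding sum_modes_box[symmetric]
    by (rule order_trans[OF *]) (intro sum_mono2 box that finite_modes_box, auto)
  then show ?thesis by blast
qed

text \<open>At the \<open>k\<close>-th eigenvalue the positive parts vanish after index
  \<open>k\<close> and are plain differences before. A small box may miss some of the first
  \<open>k\<close> modes, which costs equality but keeps the bound for every
  \<open>M\<close>.\<close>

lemma eigenvalue_sum_le:
  assumes "1 \<le> n" "1 \<le> k" "\<forall>j\<in>{1..n}. 0 < a j" "\<Lambda> = dirichlet_eigenvalue n a k"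
  shows "pi\<^sup>2 * riesz_sum {1..int M} {1..n} a (\<Lambda> / pi\<^sup>2)
    \<le> real k * \<Lambda> - real k * eigenvalue_average n k a"
proof -
  obtain e where e: "nondecreasing_listing (modes n) (mode_value n a) e"
    using dirichlet_listing_exists assms by blast
  then have bij: "bij_betw e {1..} (modes n)" and mono: "mono_on {1..} (\<lambda>k. mode_value n a (e k))"
    by (simp_all add: nondecreasing_listing_def)
  have \<Lambda>: "\<Lambda> = mode_value n a (e k)"
    using dirichlet_eigenvalue_eq[OF e assms(2)] assms(4) by simp
  have out: "\<Lambda> \<le> mode_value n a x" if x: "x \<in> ({1..n} \<rightarrow>\<^sub>E {1..M}) - e ` {1..k}" for x
  proof -
    from x have "x \<in> modes n" by (auto simp: modes_def PiE_iff)
    then obtain l where "1 \<le> l" "x = e l" using bij by (auto simp: bij_betw_def)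
    moreover from this have "k \<le> l" using x by (cases "l \<le> k") auto
    ultimately show ?thesis
      unfolding \<Lambda> using assms(2) by (auto intro: mono_onD[OF mono])
  qed
  have "pi\<^sup>2 * riesz_sum {1..int M} {1..n} a (\<Lambda> / pi\<^sup>2) =
      (\<Sum>i\<in>({1..n} \<rightarrow>\<^sub>E {1..M}) \<inter> e ` {1..k}. max 0 (\<Lambda> - mode_value n a i))"
    unfolding sum_modes_box[symmetric]
    by (intro sum.mono_neutral_right finite_modes_box) (use out in auto)
  also have "\<dots> \<le> (\<Sum>x\<in>e ` {1..k}. max 0 (\<Lambda> - mode_value n a x))"
    by (intro sum_mono2) auto
  also have "\<dots> = (\<Sum>i=1..k. max 0 (\<Lambda> - mode_value n a (e i)))"
    using bij by (subst sum.reindex) (auto simp: bij_betw_def intro: inj_on_subset)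
  also have "\<dots> = (\<Sum>i=1..k. \<Lambda> - mode_value n a (e i))"
    by (intro sum.cong refl max_absorb2) (auto simp: \<Lambda> intro!: mono_onD[OF mono])
  also have "\<dots> = real k * \<Lambda> - real k * eigenvalue_average n k a"
    using assms(2) dirichlet_eigenvalue_eq[OF e] by (simp add: eigenvalue_average_def sum_subtractf)
  finally show ?thesis .
qed

text \<open>The first \<open>k\<close> modes of the cube have all coordinates at most
  \<open>sqrt (\<Lambda> / pi\<^sup>2)\<close>; counting such vectors bounds
  \<open>k\<close>.\<close>

lemma index_le_eigenvalue_cube:
  assumes "1 \<le> n" "1 \<le> k" "\<Lambda> = dirichlet_eigenvalue n (\<lambda>_. 1) k"
  shows "0 < \<Lambda>" "real k \<le> sqrt (\<Lambda> / pi\<^sup>2) ^ n"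
proof -
  obtain e where e: "nondecreasing_listing (modes n) (mode_value n (\<lambda>_. 1)) e"
    using dirichlet_listing_exists[of n "\<lambda>_. 1"] assms by auto
  then have bij: "bij_betw e {1..} (modes n)" and mono: "mono_on {1..} (\<lambda>k. mode_value n (\<lambda>_. 1) (e k))"
    by (simp_all add: nondecreasing_listing_def)
  have \<Lambda>: "\<Lambda> = mode_value n (\<lambda>_. 1) (e k)"
    using dirichlet_eigenvalue_eq[OF e assms(2)] assms(3) by simp
  let ?m = "nat \<lfloor>sqrt (\<Lambda> / pi\<^sup>2)\<rfloor>"
  have "e ` {1..k} \<subseteq> {1..n} \<rightarrow>\<^sub>E {1..?m}"
  proof
    fix x assume "x \<in> e ` {1..k}"
    then obtain l where l: "1 \<le> l" "l \<le> k" "x = e l" by auto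
    then have x: "x \<in> modes n" using bij by (auto simp: bij_betw_def)
    have le: "mode_value n (\<lambda>_. 1) x \<le> \<Lambda>" unfolding \<Lambda> using l by (auto intro: mono_onD[OF mono])
    have "x j \<le> ?m" if "j \<in> {1..n}" for j
    proof -
      have "pi\<^sup>2 * (real (x j))\<^sup>2 / 1\<^sup>2 \<le> mode_value n (\<lambda>_. 1) x"
        unfolding mode_value_def using that by (intro member_le_sum) auto
      with le have "(real (x j))\<^sup>2 \<le> \<Lambda> / pi\<^sup>2" by (simp add: field_simps)
      then have "real (x j) \<le> sqrt (\<Lambda> / pi\<^sup>2)" by (rule real_le_rsqrt)
      then show ?thesis by (simp add: le_nat_floor)
    qed
    with x show "x \<in> {1..n} \<rightarrow>\<^sub>E {1..?m}" by (auto simp: modes_def PiE_iff)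
  qed
  then have "card (e ` {1..k}) \<le> card ({1..n} \<rightarrow>\<^sub>E {1..?m})"
    by (intro card_mono finite_modes_box)
  moreover have "card (e ` {1..k}) = k"
    using bij by (subst card_image) (auto simp: bij_betw_def intro: inj_on_subset)
  ultimately have k: "k \<le> ?m ^ n" by (simp add: card_PiE)
  then have "?m \<noteq> 0" using assms(1,2) by (intro notI) (simp add: power_0_left)
  then have pos: "0 < sqrt (\<Lambda> / pi\<^sup>2)" by linarith
  then show "0 < \<Lambda>" by (simp add: zero_less_divide_iff)
  have "real k \<le> real ?m ^ n" using k by (metis of_nat_le_iff of_nat_power)
  also have "\<dots> \<le> sqrt (\<Lambda> / pi\<^sup>2) ^ n" using pos by (intro power_mono) auto
  finally show "real k \<le> sqrt (\<Lambda> / pi\<^sup>2) ^ n" .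
qed

text \<open>Later arguments use minimality only through this comparison. \<open>M0\<close> depends
  on the cuboid, so they choose \<open>M\<close> afterwards.\<close>

lemma minimising_cuboid_riesz_sum:
  assumes "1 \<le> n" "1 \<le> k" "minimising_cuboid n k a"
  obtains \<mu> M0 where "0 < \<mu>" "real k \<le> sqrt \<mu> ^ n"
    "\<And>M. M0 \<le> M \<Longrightarrow> riesz_sum {1..int M} {1..n} (\<lambda>_. 1) \<mu> \<le> riesz_sum {1..int M} {1..n} a \<mu>"
proof -
  define \<Lambda> where "\<Lambda> = dirichlet_eigenvalue n (\<lambda>_. 1) k"
  have "unit_cuboid n (\<lambda>_. 1)" by (simp add: unit_cuboid_def mono_on_def)
  then have le: "eigenvalue_average n k a \<le> eigenvalue_average n k (\<lambda>_. 1)"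
    and pos: "\<forall>j\<in>{1..n}. 0 < a j"
    using assms(3) by (simp_all add: minimising_cuboid_def unit_cuboid_def)
  obtain M0 where M0: "\<And>M. M0 \<le> M \<Longrightarrow> real k * \<Lambda> - real k * eigenvalue_average n k a
    \<le> pi\<^sup>2 * riesz_sum {1..int M} {1..n} a (\<Lambda> / pi\<^sup>2)"
    using eigenvalue_sum_ge[OF assms(1,2) pos] by blast
  show thesis
  proof (rule that)
    show "0 < \<Lambda> / pi\<^sup>2" "real k \<le> sqrt (\<Lambda> / pi\<^sup>2) ^ n"
      using index_le_eigenvalue_cube[OF assms(1,2) \<Lambda>_def] by simp_all
    fix M assume "M0 \<le> M"
    have "real k * eigenvalue_average n k a \<le> real k * eigenvalue_average n k (\<lambda>_. 1)"
      using le by (intro mult_left_mono) auto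
    moreover have "pi\<^sup>2 * riesz_sum {1..int M} {1..n} (\<lambda>_. 1) (\<Lambda> / pi\<^sup>2)
        \<le> real k * \<Lambda> - real k * eigenvalue_average n k (\<lambda>_. 1)"
      by (rule eigenvalue_sum_le[OF assms(1,2) _ \<Lambda>_def]) simp
    ultimately have "pi\<^sup>2 * riesz_sum {1..int M} {1..n} (\<lambda>_. 1) (\<Lambda> / pi\<^sup>2) \<le>
        pi\<^sup>2 * riesz_sum {1..int M} {1..n} a (\<Lambda> / pi\<^sup>2)"
      using M0[OF \<open>M0 \<le> M\<close>] by linarith
    then show "riesz_sum {1..int M} {1..n} (\<lambda>_. 1) (\<Lambda> / pi\<^sup>2) \<le> riesz_sum {1..int M} {1..n} a (\<Lambda> / pi\<^sup>2)"
      by simp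
  qed
qed

section \<open>The full lattice\<close>

text \<open>Vectors are sorted by the set \<open>S\<close> of their nonzero coordinates; the choice
  of signs accounts for \<open>2 ^ card S\<close>.\<close>

lemma riesz_sum_symmetric:
  assumes "finite J"
  shows "riesz_sum {- int M..int M} J a \<mu> = (\<Sum>S\<in>Pow J. 2 ^ card S * riesz_sum {1..int M} S a \<mu>)"
  using assms
proof (induction J arbitrary: \<mu>)
  case (insert j J)
  have split: "(\<Sum>i\<in>{- int M..int M}. f ((real_of_int i)\<^sup>2)) = f 0 + 2 * (\<Sum>i\<in>{1..int M}. f ((real_of_int i)\<^sup>2))"
    for f :: "real \<Rightarrow> real"
  proof -
    have "{- int M..int M} = {0} \<union> ({1..int M} \<union> uminus ` {1..int M})"
      by (auto simp: image_iff intro: bexI[of _ "- _"])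
    moreover have "(\<Sum>i\<in>uminus ` {1..int M}. f ((real_of_int i)\<^sup>2)) = (\<Sum>i\<in>{1..int M}. f ((real_of_int i)\<^sup>2))"
      by (subst sum.reindex) (auto simp: inj_on_def)
    ultimately show ?thesis
      by (simp only:) (subst sum.union_disjoint, auto)+
  qed
  let ?P = "\<lambda>S. riesz_sum {1..int M} S a"
  have "riesz_sum {- int M..int M} (insert j J) a \<mu> = riesz_sum {- int M..int M} J a \<mu>
      + 2 * (\<Sum>i\<in>{1..int M}. riesz_sum {- int M..int M} J a (\<mu> - (real_of_int i)\<^sup>2 / (a j)\<^sup>2))"
    unfolding riesz_sum_insert[OF insert.hyps]
    using split[of "\<lambda>x. riesz_sum {- int M..int M} J a (\<mu> - x / (a j)\<^sup>2)"] by simp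
  also have "\<dots> = (\<Sum>S\<in>Pow J. 2 ^ card S * ?P S \<mu>)
      + (\<Sum>S\<in>Pow J. 2 ^ Suc (card S) * (\<Sum>i\<in>{1..int M}. ?P S (\<mu> - (real_of_int i)\<^sup>2 / (a j)\<^sup>2)))"
    unfolding insert.IH by (simp add: sum_distrib_left mult_ac) (rule sum.swap)
  also have "(\<Sum>S\<in>Pow J. 2 ^ Suc (card S) * (\<Sum>i\<in>{1..int M}. ?P S (\<mu> - (real_of_int i)\<^sup>2 / (a j)\<^sup>2)))
      = (\<Sum>S\<in>Pow J. 2 ^ card (insert j S) * ?P (insert j S) \<mu>)"
  proof (intro sum.cong refl)
    fix S assume "S \<in> Pow J"
    then have "finite S" "j \<notin> S" using insert.hyps finite_subset by auto
    then show "2 ^ Suc (card S) * (\<Sum>i\<in>{1..int M}. ?P S (\<mu> - (real_of_int i)\<^sup>2 / (a j)\<^sup>2))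
        = 2 ^ card (insert j S) * ?P (insert j S) \<mu>"
      by (simp add: riesz_sum_insert)
  qed
  also have "\<dots> = (\<Sum>S\<in>insert j ` Pow J. 2 ^ card S * ?P S \<mu>)"
    using insert.hyps by (subst sum.reindex) (auto simp: inj_on_def dest: insert_ident[THEN iffD1, rotated 2])
  also have "(\<Sum>S\<in>Pow J. 2 ^ card S * ?P S \<mu>) + \<dots> = (\<Sum>S\<in>Pow (insert j J). 2 ^ card S * ?P S \<mu>)"
    unfolding Pow_insert using insert.hyps by (intro sum.union_disjoint[symmetric]) auto
  finally show ?case .
qed simp

lemma ellipsoid_lattice_points_eq_box:
  assumes "\<forall>j\<in>{1..n}. 0 < a j \<and> a j \<le> L" "L * t \<le> real M" "0 \<le> t"
  shows "ellipsoid_lattice_points n a t =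
    {z \<in> {1..n} \<rightarrow>\<^sub>E {- int M..int M}. (\<Sum>i=1..n. (real_of_int (z i))\<^sup>2 / (a i)\<^sup>2) \<le> t\<^sup>2}"
proof -
  have "- int M \<le> z j \<and> z j \<le> int M" if z: "(\<Sum>i=1..n. (real_of_int (z i))\<^sup>2 / (a i)\<^sup>2) \<le> t\<^sup>2" and j: "j \<in> {1..n}" for z j
  proof -
    have "(real_of_int (z j))\<^sup>2 / (a j)\<^sup>2 \<le> (\<Sum>i=1..n. (real_of_int (z i))\<^sup>2 / (a i)\<^sup>2)"
      using j by (intro member_le_sum) auto
    with z have "(real_of_int (z j))\<^sup>2 / (a j)\<^sup>2 \<le> t\<^sup>2" by linarith
    moreover have "0 < a j" using assms(1) j by blast
    ultimately have "(real_of_int (z j))\<^sup>2 \<le> (a j * t)\<^sup>2"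
      by (simp add: field_simps power_mult_distrib)
    moreover have "0 \<le> a j * t" using assms j by (simp add: less_imp_le)
    ultimately have "\<bar>real_of_int (z j)\<bar> \<le> a j * t" using abs_le_square_iff[of "real_of_int (z j)" "a j * t"] by simp
    also have "\<dots> \<le> L * t" using assms j by (intro mult_right_mono) auto
    finally show ?thesis using assms(2) by linarith
  qed
  then show ?thesis unfolding ellipsoid_lattice_points_def by (auto simp: PiE_iff)
qed

lemma finite_ellipsoid_lattice_points:
  assumes "\<forall>j\<in>{1..n}. 0 < a j \<and> a j \<le> L" "0 \<le> t"
  shows "finite (ellipsoid_lattice_points n a t)"
proof -
  have "L * t \<le> real (nat \<lceil>L * t\<rceil>)" by linarith
  from ellipsoid_lattice_points_eq_box[OF assms(1) this assms(2)] show ?thesis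
    by (simp add: finite_PiE)
qed

lemma card_ellipsoid_mono:
  assumes "\<forall>j\<in>{1..n}. 0 < a j \<and> a j \<le> L" "0 \<le> s" "s \<le> t"
  shows "card (ellipsoid_lattice_points n a s) \<le> card (ellipsoid_lattice_points n a t)"
proof (intro card_mono finite_ellipsoid_lattice_points[OF assms(1)])
  have "s\<^sup>2 \<le> t\<^sup>2" using assms by (intro power_mono) auto
  then show "ellipsoid_lattice_points n a s \<subseteq> ellipsoid_lattice_points n a t"
    unfolding ellipsoid_lattice_points_def by auto
qed (use assms in auto)

lemma has_integral_step:
  fixes u :: real
  assumes "0 \<le> u" "0 \<le> \<mu>"
  shows "((\<lambda>s. if u \<le> s then 1 else 0) has_integral max 0 (\<mu> - u)) {0..\<mu>}"
proof (cases "u \<le> \<mu>")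
  case True
  have "((\<lambda>s. if s \<in> {u..\<mu>} then 1 else 0) has_integral (\<mu> - u)) {0..\<mu>}"
    using assms True has_integral_const_real[of "1::real" u \<mu>] by (subst has_integral_restrict) auto
  then have "((\<lambda>s. if u \<le> s then 1 else 0) has_integral (\<mu> - u)) {0..\<mu>}"
    by (rule has_integral_eq[rotated]) auto
  with True show ?thesis by simp
next
  case False
  have "((\<lambda>s. if u \<le> s then 1 else 0) has_integral (0::real)) {0..\<mu>}"
    using False by (intro has_integral_is_0) auto
  with False show ?thesis by simp
qed

text \<open>Layer-cake formula: by \<open>has_integral_step\<close> each term of the Riesz sum is
  the integral of the indicator that its point has been reached at level \<open>s\<close>.\<close>

lemma card_ellipsoid_has_integral:
  assumes "\<forall>j\<in>{1..n}. 0 < a j \<and> a j \<le> L" "L * sqrt \<mu> \<le> real M" "0 \<le> \<mu>" "0 \<le> L"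
  shows "((\<lambda>s. real (card (ellipsoid_lattice_points n a (sqrt s)))) has_integral
    riesz_sum {- int M..int M} {1..n} a \<mu>) {0..\<mu>}"
proof -
  let ?u = "\<lambda>z. \<Sum>i=1..n. (real_of_int (z i))\<^sup>2 / (a i)\<^sup>2"
  let ?B = "{1..n} \<rightarrow>\<^sub>E {- int M..int M}"
  have "finite ?B" by (intro finite_PiE) auto
  have "((\<lambda>s. \<Sum>z\<in>?B. if ?u z \<le> s then 1 else 0) has_integral riesz_sum {- int M..int M} {1..n} a \<mu>) {0..\<mu>}"
    unfolding riesz_sum_def
    using assms(3) \<open>finite ?B\<close> by (intro has_integral_sum has_integral_step) (auto intro!: sum_nonneg)
  then show ?thesis
  proof (rule has_integral_eq[rotated])
    fix s assume "s \<in> {0..\<mu>}"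
    then have "L * sqrt s \<le> L * sqrt \<mu>" using assms(4) by (intro mult_left_mono) auto
    then have "ellipsoid_lattice_points n a (sqrt s) = {z \<in> ?B. ?u z \<le> s}"
      using \<open>s \<in> {0..\<mu>}\<close> assms by (subst ellipsoid_lattice_points_eq_box[of n a L _ M]) auto
    then show "(\<Sum>z\<in>?B. if ?u z \<le> s then 1 else 0) = real (card (ellipsoid_lattice_points n a (sqrt s)))"
      using \<open>finite ?B\<close> by (simp add: sum.inter_filter[symmetric])
  qed
qed

text \<open>Equal products give equal volume terms, so the two counts differ only by the errors;
  integrating over \<open>{0..\<mu>}\<close> adds 1 to the exponent.\<close>

lemma riesz_sum_symmetric_diff_le:
  assumes "admissible_exponent n \<theta>" "0 \<le> \<theta>" "0 < lo" "lo \<le> hi"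
  shows "\<exists>C. \<forall>a b \<mu> M. (\<forall>i\<in>{1..n}. a i \<in> {lo..hi}) \<and> (\<forall>i\<in>{1..n}. b i \<in> {lo..hi})
      \<and> (\<Prod>i=1..n. a i) = (\<Prod>i=1..n. b i) \<and> 1 \<le> \<mu> \<and> hi * sqrt \<mu> \<le> real M \<longrightarrow>
    riesz_sum {- int M..int M} {1..n} a \<mu> - riesz_sum {- int M..int M} {1..n} b \<mu> \<le> C * \<mu> powr (\<theta> / 2 + 1)"
proof -
  let ?E = "\<lambda>a t. real (card (ellipsoid_lattice_points n a t))"
  let ?\<omega> = "unit_ball_vol (real n)"
  have "\<exists>C. \<forall>\<^sub>F t in at_top. \<forall>a. (\<forall>i\<in>{1..n}. a i \<in> {lo..hi}) \<longrightarrow>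
     \<bar>?E a t - ?\<omega> * t ^ n * (\<Prod>i=1..n. a i)\<bar> \<le> C * t powr \<theta>"
    using assms unfolding admissible_exponent_def by (auto elim!: allE[of _ "{lo..hi}"])
  then obtain C t1 where "\<forall>t\<ge>t1. \<forall>a. (\<forall>i\<in>{1..n}. a i \<in> {lo..hi}) \<longrightarrow>
     \<bar>?E a t - ?\<omega> * t ^ n * (\<Prod>i=1..n. a i)\<bar> \<le> C * t powr \<theta>"
    unfolding eventually_at_top_linorder by blast
  moreover define t0 where "t0 = max 1 t1"
  ultimately have C: "\<bar>?E a t - ?\<omega> * t ^ n * (\<Prod>i=1..n. a i)\<bar> \<le> C * t powr \<theta>"
    if "t0 \<le> t" "\<forall>i\<in>{1..n}. a i \<in> {lo..hi}" for a t
    using that by auto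
  have "1 \<le> t0" by (simp add: t0_def)
  define K where "K = ?\<omega> * t0 ^ n * hi ^ n + \<bar>C\<bar> * t0 powr \<theta>"
  have "0 \<le> K" using assms \<open>1 \<le> t0\<close> by (auto simp: K_def intro!: add_nonneg_nonneg mult_nonneg_nonneg)
  show ?thesis
  proof (intro exI[of _ "K + 2 * \<bar>C\<bar>"] allI impI, elim conjE)
    fix a b :: "nat \<Rightarrow> real" and \<mu> M
    assume a: "\<forall>i\<in>{1..n}. a i \<in> {lo..hi}" and b: "\<forall>i\<in>{1..n}. b i \<in> {lo..hi}"
      and ab: "(\<Prod>i=1..n. a i) = (\<Prod>i=1..n. b i)" and \<mu>: "1 \<le> \<mu>" "hi * sqrt \<mu> \<le> real M"
    have pos: "\<forall>j\<in>{1..n}. 0 < a j \<and> a j \<le> hi" "\<forall>j\<in>{1..n}. 0 < b j \<and> b j \<le> hi"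
      using a b assms(3) by auto
    have "?E a (sqrt s) - ?E b (sqrt s) \<le> (K + 2 * \<bar>C\<bar>) * \<mu> powr (\<theta> / 2)" if s: "s \<in> {0..\<mu>}" for s
    proof (cases "t0 \<le> sqrt s")
      case True
      have "0 < sqrt s" using True \<open>1 \<le> t0\<close> by linarith
      have "?E a (sqrt s) - ?E b (sqrt s) \<le> 2 * (C * sqrt s powr \<theta>)"
        using C[OF True a] C[OF True b] ab by (simp add: abs_le_iff)
      also have "\<dots> \<le> 2 * (\<bar>C\<bar> * \<mu> powr (\<theta> / 2))"
      proof -
        have "sqrt s powr \<theta> = s powr (\<theta> / 2)"
          using \<open>0 < sqrt s\<close> by (simp add: powr_half_sqrt[symmetric] powr_powr)
        also have "\<dots> \<le> \<mu> powr (\<theta> / 2)" using s assms(2) by (intro powr_mono2) auto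
        finally show ?thesis by (intro mult_left_mono mult_mono) auto
      qed
      also have "\<dots> \<le> (K + 2 * \<bar>C\<bar>) * \<mu> powr (\<theta> / 2)"
        using \<open>0 \<le> K\<close> by (simp add: algebra_simps)
      finally show ?thesis .
    next
      case False
      have "?E a (sqrt s) - ?E b (sqrt s) \<le> ?E a t0"
        using card_ellipsoid_mono[OF pos(1), of "sqrt s" t0] False s by simp
      also have "\<dots> \<le> ?\<omega> * t0 ^ n * (\<Prod>i=1..n. a i) + C * t0 powr \<theta>"
        using C[OF order_refl a] by linarith
      also have "\<dots> \<le> K"
      proof -
        have "(\<Prod>i=1..n. a i) \<le> (\<Prod>i=1..n. hi)" using pos by (intro prod_mono) (auto simp: less_imp_le)
        then show ?thesis
          unfolding K_def using \<open>1 \<le> t0\<close> by (intro add_mono mult_left_mono mult_right_mono) auto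
      qed
      \<comment> \<open>From \<open>0 \<le> \<theta>\<close> and \<open>1 \<le> \<mu>\<close> the
        power is at least 1.\<close>
      also have "\<dots> \<le> (K + 2 * \<bar>C\<bar>) * \<mu> powr (\<theta> / 2)"
        using \<open>0 \<le> K\<close> ge_one_powr_ge_zero[OF \<mu>(1), of "\<theta> / 2"] assms(2)
        by (smt (verit) abs_ge_zero divide_nonneg_nonneg mult_le_cancel_left1)
      finally show ?thesis .
    qed
    then have "riesz_sum {- int M..int M} {1..n} a \<mu> - riesz_sum {- int M..int M} {1..n} b \<mu>
        \<le> (\<mu> - 0) *\<^sub>R ((K + 2 * \<bar>C\<bar>) * \<mu> powr (\<theta> / 2))"
      using \<mu> assms(3,4) has_integral_const_real[of "(K + 2 * \<bar>C\<bar>) * \<mu> powr (\<theta> / 2)" 0 \<mu>]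
      by (intro has_integral_le[OF has_integral_diff[OF card_ellipsoid_has_integral[OF pos(1)] card_ellipsoid_has_integral[OF pos(2)]]])
        auto
    also have "\<dots> = (K + 2 * \<bar>C\<bar>) * \<mu> powr (\<theta> / 2 + 1)"
      using \<mu> by (simp add: powr_add)
    finally show "riesz_sum {- int M..int M} {1..n} a \<mu> - riesz_sum {- int M..int M} {1..n} b \<mu>
      \<le> (K + 2 * \<bar>C\<bar>) * \<mu> powr (\<theta> / 2 + 1)" .
  qed
qed

section \<open>The lower bound for admissible exponents\<close>

text \<open>A sum of integer squares is an integer, so none lies strictly between \<open>m\<close>
  and \<open>m + 1/2\<close> or at \<open>m + 1/2\<close>.\<close>

lemma ellipsoid_lattice_points_sqrt_half:
  "ellipsoid_lattice_points n (\<lambda>_. 1) (sqrt (real m + 1/2)) = ellipsoid_lattice_points n (\<lambda>_. 1) (sqrt (real m))"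
proof -
  have "(\<Sum>i=1..n. (real_of_int (z i))\<^sup>2 / 1\<^sup>2) \<le> real m + 1/2 \<longleftrightarrow> (\<Sum>i=1..n. (real_of_int (z i))\<^sup>2 / 1\<^sup>2) \<le> real m" for z
  proof -
    have eq: "(\<Sum>i=1..n. (real_of_int (z i))\<^sup>2 / 1\<^sup>2) = real_of_int (\<Sum>i=1..n. (z i)\<^sup>2)" by simp
    have "real_of_int x \<le> real m + 1/2 \<longleftrightarrow> real_of_int x \<le> real m" for x
    proof
      assume "real_of_int x \<le> real m + 1/2"
      then have "real_of_int (x - int m) < 1" by simp
      then have "x \<le> int m" by (simp only: of_int_less_1_iff)
      then show "real_of_int x \<le> real m" by linarith
    qed simp
    then show ?thesis unfolding eq .
  qed
  then show ?thesis unfolding ellipsoid_lattice_points_def by simp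
qed

text \<open>
  For the unit ball the count is constant on \<open>[sqrt m, sqrt (m + 1/2)]\<close>, while the volume grows there by
  at least a multiple of \<open>m\<^bsup>n/2-1\<^esup>\<close>.
\<close>
lemma admissible_exponent_ge:
  assumes "2 \<le> n" "admissible_exponent n \<theta>"
  shows "real n - 2 \<le> \<theta>"
proof (rule ccontr)
  assume "\<not> real n - 2 \<le> \<theta>"
  obtain p where n: "n = p + 2" using assms(1) by (metis add.commute le_Suc_ex)
  with \<open>\<not> real n - 2 \<le> \<theta>\<close> have neg: "\<theta> - real p < 0" by simp
  let ?\<omega> = "unit_ball_vol (real n)"
  let ?E = "\<lambda>t. real (card (ellipsoid_lattice_points n (\<lambda>_. 1) t))"
  have "\<exists>C. \<forall>\<^sub>F t in at_top. \<forall>a. (\<forall>i\<in>{1..n}. a i \<in> {1}) \<longrightarrow>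
     \<bar>real (card (ellipsoid_lattice_points n a t)) - ?\<omega> * t ^ n * (\<Prod>i=1..n. a i)\<bar> \<le> C * t powr \<theta>"
    using assms(2) unfolding admissible_exponent_def by (auto elim!: allE[of _ "{1}"])
  then obtain C where "\<forall>\<^sub>F t in at_top. \<forall>a. (\<forall>i\<in>{1..n}. a i \<in> {1}) \<longrightarrow>
     \<bar>real (card (ellipsoid_lattice_points n a t)) - ?\<omega> * t ^ n * (\<Prod>i=1..n. a i)\<bar> \<le> C * t powr \<theta>"
    by blast
  then have C: "\<forall>\<^sub>F t in at_top. \<bar>?E t - ?\<omega> * t ^ n\<bar> \<le> C * t powr \<theta>"
    by (rule eventually_mono) (auto dest: spec[of _ "\<lambda>_. 1::real"])
  \<comment> \<open>Chosen so that the errors at \<open>s\<close> and at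
    \<open>t \<le> 2 * s\<close> add up to \<open>?\<omega> / 4 * s ^ p\<close>, half of the volume
    growth found below.\<close>
  define \<epsilon> where "\<epsilon> = ?\<omega> / (4 * (1 + 2 ^ p))"
  have "0 < ?\<omega>" by (simp add: unit_ball_vol_pos)
  then have "0 < \<epsilon>" by (simp add: \<epsilon>_def add_pos_pos)
  have "((\<lambda>t. C * t powr (\<theta> - real p)) \<longlongrightarrow> C * 0) at_top"
    using neg by (intro tendsto_mult tendsto_const tendsto_neg_powr filterlim_ident)
  then have "\<forall>\<^sub>F t in at_top. C * t powr (\<theta> - real p) < \<epsilon>"
    using \<open>0 < \<epsilon>\<close> by (auto dest: order_tendstoD(2))
  then have "\<forall>\<^sub>F t in at_top. \<bar>?E t - ?\<omega> * t ^ n\<bar> \<le> \<epsilon> * t ^ p"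
    using C eventually_gt_at_top[of 0]
  proof eventually_elim
    case (elim t)
    have "C * t powr \<theta> = C * t powr (\<theta> - real p) * t ^ p"
      using elim(3) by (simp add: powr_diff powr_realpow)
    also have "\<dots> \<le> \<epsilon> * t ^ p" using elim by (intro mult_right_mono) auto
    finally show ?case using elim(2) by linarith
  qed
  then obtain t0 where t0: "\<And>t. t0 \<le> t \<Longrightarrow> \<bar>?E t - ?\<omega> * t ^ n\<bar> \<le> \<epsilon> * t ^ p"
    unfolding eventually_at_top_linorder by blast
  define m where "m = nat \<lceil>(max 1 t0)\<^sup>2\<rceil>"
  define s t where "s = sqrt (real m)" and "t = sqrt (real m + 1/2)"
  have "(max 1 t0)\<^sup>2 \<le> real m" unfolding m_def by linarith
  then have s: "max 1 t0 \<le> s" unfolding s_def by (rule real_le_rsqrt)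
  have "s \<le> t" by (simp add: s_def t_def)
  have "1 \<le> real m" using s by (simp add: s_def)
  then have "t \<le> sqrt (4 * real m)" unfolding t_def by simp
  then have "t \<le> 2 * s" by (simp add: s_def real_sqrt_mult)
  have sq: "s ^ n = real m * s ^ p" "t ^ n = (real m + 1/2) * t ^ p"
    by (simp_all add: n s_def t_def power_add)
  have "s ^ p \<le> t ^ p" using s \<open>s \<le> t\<close> by (intro power_mono) auto
  then have "(real m + 1/2) * s ^ p \<le> t ^ n" unfolding sq by (intro mult_left_mono) auto
  then have "s ^ p / 2 \<le> t ^ n - s ^ n" by (simp add: sq algebra_simps)
  then have "?\<omega> * (s ^ p / 2) \<le> ?\<omega> * (t ^ n - s ^ n)"
    using \<open>0 < ?\<omega>\<close> by (intro mult_left_mono) auto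
  also have "\<dots> \<le> \<epsilon> * s ^ p + \<epsilon> * t ^ p"
  proof -
    have "t0 \<le> s" "t0 \<le> t" using s \<open>s \<le> t\<close> by auto
    moreover have "?E t = ?E s" by (simp only: s_def t_def ellipsoid_lattice_points_sqrt_half)
    ultimately show ?thesis using t0[of s] t0[of t] unfolding right_diff_distrib by linarith
  qed
  also have "\<dots> \<le> \<epsilon> * s ^ p + \<epsilon> * (2 * s) ^ p"
    using \<open>0 < \<epsilon>\<close> s \<open>t \<le> 2 * s\<close> \<open>s \<le> t\<close> by (intro add_left_mono mult_left_mono power_mono) auto
  also have "\<dots> = ?\<omega> / 4 * s ^ p"
  proof -
    have "\<epsilon> * (1 + 2 ^ p) = ?\<omega> / 4"
      unfolding \<epsilon>_def using add_pos_pos[of 1 "2 ^ p :: real"] by (simp add: field_simps)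
    then show ?thesis by (simp add: power_mult_distrib algebra_simps) (metis distrib_left mult.assoc mult.commute mult.right_neutral)
  qed
  finally show False using \<open>0 < ?\<omega>\<close> s by (simp add: zero_less_power)
qed

section \<open>Sides of minimisers\<close>

lemma unit_cuboid_prod_remove:
  assumes "unit_cuboid n a" "j \<in> {1..n}"
  shows "(\<Prod>i\<in>{1..n} - {j}. a i) = 1 / a j"
proof -
  have "a j * (\<Prod>i\<in>{1..n} - {j}. a i) = 1"
    using assms prod.remove[of "{1..n}" j a] by (simp add: unit_cuboid_def)
  moreover have "0 < a j" using assms by (simp add: unit_cuboid_def)
  ultimately show ?thesis by (simp add: field_simps)
qed

text \<open>The other sides have product at least \<open>lo ^ (n - 1)\<close>, hence at least
  \<open>lo ^ n\<close> as \<open>lo \<le> 1\<close>, and the total product is 1.\<close>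

lemma unit_cuboid_le:
  assumes "unit_cuboid n a" "\<forall>i\<in>{1..n}. lo \<le> a i" "0 < lo" "lo \<le> 1" "j \<in> {1..n}"
  shows "a j \<le> (1 / lo) ^ n"
proof -
  have "lo ^ n \<le> lo ^ card ({1..n} - {j})"
    using assms by (intro power_decreasing) auto
  also have "\<dots> \<le> (\<Prod>i\<in>{1..n} - {j}. a i)"
    unfolding prod_constant[symmetric] using assms by (intro prod_mono) auto
  also have "\<dots> = 1 / a j" using assms by (intro unit_cuboid_prod_remove)
  finally have "lo ^ n \<le> 1 / a j" .
  moreover have "0 < a j" using assms by fastforce
  ultimately show ?thesis using assms(3) by (simp add: field_simps)
qed

text \<open>The cube's Riesz sum is at least \<open>?\<beta> * ?X - C * ?Y\<close>, the minimiser's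
  at most \<open>?\<beta> * ?X - g / a j * ?Y\<close>. Comparing them bounds
  \<open>1 / a j\<close>.\<close>

lemma minimising_cuboid_sides_ge:
  assumes "1 \<le> n"
  obtains lo k0 where "0 < lo" "lo \<le> 1" "1 \<le> k0"
    "\<And>k a j. k0 \<le> k \<Longrightarrow> minimising_cuboid n k a \<Longrightarrow> j \<in> {1..n} \<Longrightarrow> lo \<le> a j"
proof -
  let ?I = "{1..n}"
  let ?\<beta> = "slice_const n"
  obtain C0 where C0: "\<And>a \<mu> M. \<forall>j\<in>?I. 0 < a j \<and> a j \<le> 1 \<Longrightarrow> 1 * sqrt \<mu> \<le> real M \<Longrightarrow>
    slice_const (card ?I) * (\<Prod>j\<in>?I. a j) * max 0 \<mu> powr (1 + real (card ?I) / 2)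
      - C0 * max 0 \<mu> powr ((1 + real (card ?I)) / 2) \<le> riesz_sum {1..int M} ?I a \<mu>"
    using riesz_sum_ge[of ?I 1] by blast
  define C where "C = \<bar>C0\<bar> + 1"
  define g where "g = slice_const (n - 1) * ((3/4) powr (real (n - 1) / 2) / 64)"
  define lo where "lo = min 1 (g / C)"
  \<comment> \<open>Forces \<open>C / ?\<beta> < sqrt \<mu>\<close>, so that the lower bound is
    positive and \<open>riesz_sum_eq_0\<close> is excluded for the minimiser.\<close>
  define k0 where "k0 = Suc (nat \<lceil>(C / ?\<beta>) ^ n\<rceil>)"
  have "0 < C" "0 < g" "0 < ?\<beta>" using slice_const_pos by (simp_all add: C_def g_def)
  show thesis
  proof (rule that)
    show "0 < lo" "lo \<le> 1" "1 \<le> k0" using \<open>0 < C\<close> \<open>0 < g\<close> by (simp_all add: lo_def k0_def)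
    fix k a j assume k: "k0 \<le> k" and a: "minimising_cuboid n k a" and j: "j \<in> ?I"
    then have "1 \<le> k" by (simp add: k0_def)
    obtain \<mu> M0 where \<mu>: "0 < \<mu>" "real k \<le> sqrt \<mu> ^ n"
      and M0: "\<And>M. M0 \<le> M \<Longrightarrow> riesz_sum {1..int M} ?I (\<lambda>_. 1) \<mu> \<le> riesz_sum {1..int M} ?I a \<mu>"
      using minimising_cuboid_riesz_sum[OF assms \<open>1 \<le> k\<close> a] by blast
    have unit: "unit_cuboid n a" using a by (simp add: minimising_cuboid_def)
    then have pos: "\<And>i. i \<in> ?I \<Longrightarrow> 0 < a i" by (simp add: unit_cuboid_def)
    define M where "M = max M0 (nat \<lceil>sqrt \<mu>\<rceil>)"
    have M: "M0 \<le> M" "1 * sqrt \<mu> \<le> real M" unfolding M_def by linarith+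
    let ?X = "\<mu> powr (1 + real n / 2)" and ?Y = "\<mu> powr ((1 + real n) / 2)"
    have X: "?X = ?Y * sqrt \<mu>"
      using \<mu>(1) by (simp add: powr_half_sqrt[symmetric] powr_add[symmetric] add_divide_distrib)
    have "?\<beta> * ?X - C * ?Y \<le> ?\<beta> * ?X - C0 * ?Y" by (simp add: C_def mult_right_mono)
    also have "\<dots> \<le> riesz_sum {1..int M} ?I a \<mu>"
      using C0[of "\<lambda>_. 1" \<mu> M] M M0[of M] \<mu> by simp
    finally have ge: "?\<beta> * ?X - C * ?Y \<le> riesz_sum {1..int M} ?I a \<mu>" .
    have "(C / ?\<beta>) ^ n < real k" using k real_nat_ceiling_ge[of "(C / ?\<beta>) ^ n"]
      unfolding k0_def by (metis Suc_le_lessD le_less_trans of_nat_less_iff)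
    then have "(C / ?\<beta>) ^ n < sqrt \<mu> ^ n" using \<mu>(2) by linarith
    then have "C / ?\<beta> < sqrt \<mu>" using \<mu>(1) by (meson less_imp_le power_less_imp_less_base real_sqrt_ge_zero)
    then have "0 < (?\<beta> * sqrt \<mu> - C) * ?Y" using \<mu>(1) \<open>0 < ?\<beta>\<close> by (simp add: field_simps)
    then have "0 < riesz_sum {1..int M} ?I a \<mu>" using ge by (simp add: X algebra_simps)
    then have "1 \<le> a j * sqrt \<mu>"
      using riesz_sum_eq_0[of ?I j a \<mu> M] pos j by force
    then have "riesz_sum {1..int M} (insert j (?I - {j})) a \<mu> \<le>
        slice_const (Suc (card (?I - {j}))) * (\<Prod>i\<in>insert j (?I - {j}). a i) * \<mu> powr (1 + real (Suc (card (?I - {j}))) / 2)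
        - slice_const (card (?I - {j})) * (\<Prod>i\<in>?I - {j}. a i) * ((3/4) powr (real (card (?I - {j})) / 2) / 64)
          * \<mu> powr (1 + real (card (?I - {j})) / 2)"
      using \<mu> pos j by (intro riesz_sum_le_gain) auto
    moreover have "insert j (?I - {j}) = ?I" "card (?I - {j}) = n - 1" "Suc (n - 1) = n" using j by auto
    moreover have "(\<Prod>i\<in>?I. a i) = 1" using unit by (simp add: unit_cuboid_def)
    moreover have "1 + real (n - 1) / 2 = (1 + real n) / 2" using assms by (simp add: field_simps of_nat_diff)
    ultimately have "riesz_sum {1..int M} ?I a \<mu> \<le> ?\<beta> * 1 * ?X
        - slice_const (n - 1) * (1 / a j) * ((3/4) powr (real (n - 1) / 2) / 64) * ?Y"
      by (simp only: unit_cuboid_prod_remove[OF unit j])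
    then have "riesz_sum {1..int M} ?I a \<mu> \<le> ?\<beta> * ?X - g / a j * ?Y"
      by (simp add: g_def)
    with ge have "g / a j * ?Y \<le> C * ?Y" by linarith
    then have "g / a j \<le> C" by (rule mult_right_le_imp_le) (use \<mu>(1) in simp)
    then show "lo \<le> a j" using pos[OF j] \<open>0 < C\<close> by (simp add: lo_def field_simps min_le_iff_disj)
  qed
qed

text \<open>Sorts the faces in \<open>riesz_sum_symmetric\<close> by codimension 0, 1 and at least
  2, that is, by order of magnitude.\<close>

lemma sum_Pow_top_two:
  fixes f :: "'a set \<Rightarrow> real"
  assumes "finite I" "2 \<le> card I"
  shows "(\<Sum>S\<in>Pow I. f S) = f I + (\<Sum>j\<in>I. f (I - {j})) + (\<Sum>S\<in>{S \<in> Pow I. card S \<le> card I - 2}. f S)"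
proof -
  let ?T = "(\<lambda>j. I - {j}) ` I" and ?R = "{S \<in> Pow I. card S \<le> card I - 2}"
  have "S \<in> insert I ?T \<union> ?R" if "S \<in> Pow I" for S
  proof (rule ccontr)
    assume not: "S \<notin> insert I ?T \<union> ?R"
    have "finite S" using that assms(1) finite_subset by auto
    have "card (I - S) = card I - card S" "card S \<le> card I"
      using that assms(1) \<open>finite S\<close> by (auto intro: card_Diff_subset card_mono)
    moreover have "card I - 2 < card S" using not that by simp
    ultimately consider "card (I - S) = 0" | "card (I - S) = 1" by linarith
    then show False
    proof cases
      case 1
      then have "I = S" using that assms(1) by auto
      with not show False by simp
    next
      case 2
      then obtain j where "I - S = {j}" by (auto simp: card_1_singleton_iff)
      then have "S = I - {j}" "j \<in> I" using that by auto
      with not show False by auto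
    qed
  qed
  moreover have "insert I ?T \<union> ?R \<subseteq> Pow I" by auto
  ultimately have "sum f (Pow I) = sum f (insert I ?T \<union> ?R)"
    by (intro arg_cong[where f = "sum f"] equalityI subsetI) blast+
  also have "\<dots> = sum f (insert I ?T) + sum f ?R"
    using assms by (intro sum.union_disjoint) auto
  also have "sum f (insert I ?T) = f I + sum f ?T"
    using assms(1) by (intro sum.insert) auto
  also have "sum f ?T = (\<Sum>j\<in>I. f (I - {j}))"
    by (subst sum.reindex) (auto simp: inj_on_def)
  finally show ?thesis .
qed

text \<open>The full lattice sums of \<open>a\<close> and the cube nearly agree while the positive
  orthant sum of \<open>a\<close> is at least the cube's. So the hyperplane terms of
  \<open>a\<close>, of size \<open>1 / a j\<close>, can hardly exceed those of the cube.\<close>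

lemma sum_inverse_sides_le:
  assumes "2 \<le> n" "admissible_exponent n \<theta>" "0 < lo" "lo \<le> 1" "1 \<le> hi"
  obtains C where "\<And>a \<mu> M. unit_cuboid n a \<Longrightarrow> \<forall>i\<in>{1..n}. a i \<in> {lo..hi} \<Longrightarrow> 1 \<le> \<mu> \<Longrightarrow> hi * sqrt \<mu> \<le> real M \<Longrightarrow>
      riesz_sum {1..int M} {1..n} (\<lambda>_. 1) \<mu> \<le> riesz_sum {1..int M} {1..n} a \<mu> \<Longrightarrow>
      (\<Sum>j=1..n. 1 / a j - 1) \<le> C * \<mu> powr ((\<theta> - (real n - 1)) / 2)"
proof -
  let ?I = "{1..n}"
  let ?\<beta> = "slice_const (n - 1)"
  have \<theta>: "real n - 2 \<le> \<theta>" using assms by (intro admissible_exponent_ge)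
  obtain D where D: "\<And>a b \<mu> M. \<forall>i\<in>?I. a i \<in> {lo..hi} \<Longrightarrow> \<forall>i\<in>?I. b i \<in> {lo..hi} \<Longrightarrow>
      (\<Prod>i=1..n. a i) = (\<Prod>i=1..n. b i) \<Longrightarrow> 1 \<le> \<mu> \<Longrightarrow> hi * sqrt \<mu> \<le> real M \<Longrightarrow>
    riesz_sum {- int M..int M} ?I a \<mu> - riesz_sum {- int M..int M} ?I b \<mu> \<le> D * \<mu> powr (\<theta> / 2 + 1)"
  proof -
    have "0 \<le> \<theta>" "lo \<le> hi" using \<theta> assms by auto
    from riesz_sum_symmetric_diff_le[OF assms(2) this(1) assms(3) this(2)] show thesis
      using that by blast
  qed
  have "\<forall>j\<in>?I. \<exists>C. \<forall>a \<mu> M. (\<forall>i\<in>?I - {j}. 0 < a i \<and> a i \<le> hi) \<and> hi * sqrt \<mu> \<le> real M \<longrightarrow>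
    slice_const (card (?I - {j})) * (\<Prod>i\<in>?I - {j}. a i) * max 0 \<mu> powr (1 + real (card (?I - {j})) / 2)
      - C * max 0 \<mu> powr ((1 + real (card (?I - {j}))) / 2) \<le> riesz_sum {1..int M} (?I - {j}) a \<mu>"
    by (intro ballI riesz_sum_ge) simp
  from bchoice[OF this] obtain c where c: "\<And>j a \<mu> M. j \<in> ?I \<Longrightarrow> \<forall>i\<in>?I - {j}. 0 < a i \<and> a i \<le> hi \<Longrightarrow> hi * sqrt \<mu> \<le> real M \<Longrightarrow>
    slice_const (card (?I - {j})) * (\<Prod>i\<in>?I - {j}. a i) * max 0 \<mu> powr (1 + real (card (?I - {j})) / 2)
      - c j * max 0 \<mu> powr ((1 + real (card (?I - {j}))) / 2) \<le> riesz_sum {1..int M} (?I - {j}) a \<mu>"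
    by blast
  define R where "R = (\<Sum>S\<in>{S \<in> Pow ?I. card S \<le> n - 2}. 2 ^ card S * slice_const (card S))"
  define S where "S = (\<Sum>j\<in>?I. \<bar>c j\<bar>)"
  define E where "E = \<bar>D\<bar> + R + 2 ^ (n - 1) * S"
  define b where "b = 2 ^ (n - 1) * ?\<beta>"
  have "0 < b" using slice_const_pos by (simp add: b_def)
  have "0 \<le> S" unfolding S_def by (intro sum_nonneg) auto
  have "0 \<le> R" unfolding R_def by (intro sum_nonneg mult_nonneg_nonneg) (auto simp: slice_const_pos less_imp_le)
  show thesis
  proof (rule that[of "E / b"])
    fix a \<mu> M
    assume unit: "unit_cuboid n a" and a: "\<forall>i\<in>?I. a i \<in> {lo..hi}" and \<mu>: "1 \<le> \<mu>" and M: "hi * sqrt \<mu> \<le> real M"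
      and le: "riesz_sum {1..int M} ?I (\<lambda>_. 1) \<mu> \<le> riesz_sum {1..int M} ?I a \<mu>"
    define W where "W = (\<Sum>j=1..n. 1 / a j - 1)"
    let ?P = "riesz_sum {1..int M}"
    let ?x = "\<mu> powr ((real n + 1) / 2)" and ?y = "\<mu> powr (real n / 2)" and ?z = "\<mu> powr (\<theta> / 2 + 1)"
    have exps: "1 + real (n - 1) / 2 = (real n + 1) / 2" "(1 + real (n - 1)) / 2 = real n / 2"
      using assms(1) by (simp_all add: of_nat_diff field_simps)
    have Z: "riesz_sum {- int M..int M} ?I w \<mu> = 2 ^ n * ?P ?I w \<mu>
        + 2 ^ (n - 1) * (\<Sum>j\<in>?I. ?P (?I - {j}) w \<mu>)
        + (\<Sum>S\<in>{S \<in> Pow ?I. card S \<le> n - 2}. 2 ^ card S * ?P S w \<mu>)" for w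
      using assms(1) by (simp add: riesz_sum_symmetric sum_Pow_top_two sum_distrib_left)
    \<comment> \<open>For \<open>a\<close> the two-sided asymptotics is needed only from below, for
      the cube only from above, where \<open>riesz_sum_le\<close> has no error term.\<close>
    have "?\<beta> * ?x * (1 / a j - 1) - \<bar>c j\<bar> * ?y \<le> ?P (?I - {j}) a \<mu> - ?P (?I - {j}) (\<lambda>_. 1) \<mu>" if j: "j \<in> ?I" for j
    proof -
      have card: "card (?I - {j}) = n - 1" and max: "max 0 \<mu> = \<mu>" using j \<mu> by auto
      have "\<forall>i\<in>?I - {j}. 0 < a i \<and> a i \<le> hi" using a assms(3) by fastforce
      from c[OF j this M] have "?\<beta> * (1 / a j) * ?x - c j * ?y \<le> ?P (?I - {j}) a \<mu>"
        by (simp only: card max exps unit_cuboid_prod_remove[OF unit j])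
      moreover have "?P (?I - {j}) (\<lambda>_. 1) \<mu> \<le> ?\<beta> * ?x"
        using riesz_sum_le[of "?I - {j}" "\<lambda>_. 1" M \<mu>] unfolding card max exps by simp
      moreover have "c j * ?y \<le> \<bar>c j\<bar> * ?y" by (intro mult_right_mono) auto
      ultimately show ?thesis by (simp add: algebra_simps)
    qed
    then have "2 ^ (n - 1) * (\<Sum>j\<in>?I. ?\<beta> * ?x * (1 / a j - 1) - \<bar>c j\<bar> * ?y)
        \<le> 2 ^ (n - 1) * (\<Sum>j\<in>?I. ?P (?I - {j}) a \<mu> - ?P (?I - {j}) (\<lambda>_. 1) \<mu>)"
      by (intro mult_left_mono sum_mono) auto
    also have "\<dots> = 2 ^ (n - 1) * (\<Sum>j\<in>?I. ?P (?I - {j}) a \<mu>)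
        - 2 ^ (n - 1) * (\<Sum>j\<in>?I. ?P (?I - {j}) (\<lambda>_. 1) \<mu>)"
      by (simp only: sum_subtractf right_diff_distrib)
    also have "(\<Sum>j\<in>?I. ?\<beta> * ?x * (1 / a j - 1) - \<bar>c j\<bar> * ?y) = ?\<beta> * ?x * W - S * ?y"
      unfolding W_def S_def by (simp only: sum_distrib_left sum_distrib_right) (rule sum_subtractf)
    finally have "2 ^ (n - 1) * (?\<beta> * ?x * W - S * ?y) \<le> 2 ^ (n - 1) * (\<Sum>j\<in>?I. ?P (?I - {j}) a \<mu>)
        - 2 ^ (n - 1) * (\<Sum>j\<in>?I. ?P (?I - {j}) (\<lambda>_. 1) \<mu>)" .
    moreover have "(\<Sum>S\<in>{S \<in> Pow ?I. card S \<le> n - 2}. 2 ^ card S * ?P S (\<lambda>_. 1) \<mu>) \<le> R * ?y"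
      unfolding R_def sum_distrib_right
    proof (intro sum_mono)
      fix T assume T: "T \<in> {S \<in> Pow ?I. card S \<le> n - 2}"
      then have "finite T" using finite_subset by auto
      have "?P T (\<lambda>_. 1) \<mu> \<le> slice_const (card T) * \<mu> powr (1 + real (card T) / 2)"
        using riesz_sum_le[OF \<open>finite T\<close>, of "\<lambda>_. 1" M \<mu>] \<mu> by simp
      also have "\<dots> \<le> slice_const (card T) * ?y"
        using T \<mu> assms(1) slice_const_pos[of "card T"] by (intro mult_left_mono powr_mono) auto
      finally show "2 ^ card T * ?P T (\<lambda>_. 1) \<mu> \<le> 2 ^ card T * slice_const (card T) * ?y" by simp
    qed
    \<comment> \<open>Faces of codimension at least 2: for \<open>a\<close> nonnegativity suffices,
      for the cube the bound \<open>R * ?y\<close> above.\<close>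
    moreover have "0 \<le> (\<Sum>S\<in>{S \<in> Pow ?I. card S \<le> n - 2}. 2 ^ card S * ?P S a \<mu>)"
      by (intro sum_nonneg mult_nonneg_nonneg riesz_sum_nonneg) auto
    moreover have "2 ^ n * ?P ?I (\<lambda>_. 1) \<mu> \<le> 2 ^ n * ?P ?I a \<mu>" using le by simp
    moreover have "riesz_sum {- int M..int M} ?I a \<mu> - riesz_sum {- int M..int M} ?I (\<lambda>_. 1) \<mu> \<le> D * ?z"
      using unit a \<mu> M assms by (intro D) (auto simp: unit_cuboid_def)
    ultimately have "2 ^ (n - 1) * (?\<beta> * ?x * W - S * ?y) \<le> D * ?z + R * ?y"
      unfolding Z by linarith
    then have "b * ?x * W \<le> D * ?z + (R + 2 ^ (n - 1) * S) * ?y"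
      by (simp add: b_def algebra_simps)
    \<comment> \<open>Here \<open>real n - 2 \<le> \<theta>\<close> enters: it gives
      \<open>?y \<le> ?z\<close>.\<close>
    also have "\<dots> \<le> \<bar>D\<bar> * ?z + (R + 2 ^ (n - 1) * S) * ?z"
      using \<mu> \<theta> \<open>0 \<le> R\<close> \<open>0 \<le> S\<close> by (intro add_mono mult_mono mult_right_mono powr_mono)
        (auto intro!: add_nonneg_nonneg mult_nonneg_nonneg sum_nonneg)
    also have "\<dots> = E * (\<mu> powr ((\<theta> - (real n - 1)) / 2) * ?x)"
      by (simp add: E_def powr_add[symmetric] algebra_simps diff_divide_distrib add_divide_distrib)
    finally have "b * W * ?x \<le> E * \<mu> powr ((\<theta> - (real n - 1)) / 2) * ?x" by (simp only: mult_ac)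
    then have "b * W \<le> E * \<mu> powr ((\<theta> - (real n - 1)) / 2)"
      by (rule mult_right_le_imp_le) (use \<mu> in simp)
    then show "(\<Sum>j=1..n. 1 / a j - 1) \<le> E / b * \<mu> powr ((\<theta> - (real n - 1)) / 2)"
      unfolding W_def[symmetric]
      using \<mu> \<open>0 < b\<close> by (simp add: field_simps)
  qed
qed

text \<open>Since the logarithms of the sides sum to 0, they may be added to the deviations, making
  every summand nonnegative; the one at \<open>n\<close> alone is then kept.\<close>

lemma longest_side_deviation:
  assumes "unit_cuboid n a" "1 \<le> n" "a n \<le> hi"
  shows "1 \<le> a n" "(a n - 1)\<^sup>2 \<le> 4 * hi\<^sup>2 * (\<Sum>j=1..n. 1 / a j - 1)"
proof -
  have pos: "\<And>j. j \<in> {1..n} \<Longrightarrow> 0 < a j" and prod: "(\<Prod>j=1..n. a j) = 1" and mono: "mono_on {1..n} a"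
    using assms(1) by (simp_all add: unit_cuboid_def)
  show "1 \<le> a n"
  proof (rule ccontr)
    assume "\<not> 1 \<le> a n"
    have "(\<Prod>j=1..n. a j) \<le> (\<Prod>j=1..n. a n)"
      using pos assms(2) by (intro prod_mono conjI mono_onD[OF mono]) (auto simp: less_imp_le)
    also have "\<dots> < 1" using \<open>\<not> 1 \<le> a n\<close> pos[of n] assms(2) by (simp add: power_less_one_iff)
    finally show False using prod by simp
  qed
  have "0 < a n" using pos assms(2) by simp
  have "ln (\<Prod>j=1..n. a j) = (\<Sum>j=1..n. ln (a j))" using pos by (intro ln_prod) fastforce+
  then have sum: "(\<Sum>j=1..n. 1 / a j - 1) = (\<Sum>j=1..n. 1 / a j - 1 + ln (a j))"
    using prod by (simp add: sum.distrib)
  have nonneg: "0 \<le> 1 / a j - 1 + ln (a j)" if "j \<in> {1..n}" for j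
    using ln_le_minus_one[of "1 / a j"] pos[OF that] by (simp add: ln_div)
  \<comment> \<open>Applying \<open>ln s \<le> s - 1\<close> to the square root turns it into a quadratic bound.\<close>
  define s where "s = sqrt (1 / a n)"
  have s: "0 < s" "s \<le> 1" "s\<^sup>2 = 1 / a n"
    using \<open>1 \<le> a n\<close> by (auto simp: s_def)
  have "ln (1 / a n) = 2 * ln s" using s(1) ln_realpow[of s 2] by (simp add: s(3))
  then have "- ln (a n) \<le> 2 * (s - 1)"
    using ln_le_minus_one[OF s(1)] \<open>0 < a n\<close> by (simp add: ln_div)
  then have "(s - 1)\<^sup>2 \<le> 1 / a n - 1 + ln (a n)"
    by (simp add: power2_diff s(3))
  also have "\<dots> \<le> (\<Sum>j=1..n. 1 / a j - 1)"
    unfolding sum using assms(2) nonneg by (intro member_le_sum) auto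
  finally have le: "(s - 1)\<^sup>2 \<le> (\<Sum>j=1..n. 1 / a j - 1)" .
  \<comment> \<open>From \<open>s\<^sup>2 = 1 / a n\<close>; the bound \<open>1 + s \<le> 2\<close>
    below produces the factor 4 after squaring.\<close>
  have "a n - 1 = a n * ((1 - s) * (1 + s))"
    using \<open>0 < a n\<close> s(3) by (simp add: algebra_simps power2_eq_square)
  also have "\<dots> \<le> hi * ((1 - s) * 2)"
    using assms(3) \<open>0 < a n\<close> s by (intro mult_mono) auto
  finally have "(a n - 1)\<^sup>2 \<le> (hi * ((1 - s) * 2))\<^sup>2"
    using \<open>1 \<le> a n\<close> by (intro power_mono) auto
  also have "\<dots> = 4 * hi\<^sup>2 * (s - 1)\<^sup>2" by (simp add: power2_eq_square algebra_simps)
  also have "\<dots> \<le> 4 * hi\<^sup>2 * (\<Sum>j=1..n. 1 / a j - 1)" using le by (intro mult_left_mono) auto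
  finally show "(a n - 1)\<^sup>2 \<le> 4 * hi\<^sup>2 * (\<Sum>j=1..n. 1 / a j - 1)" .
qed

theorem proposition4p3:
  fixes n :: nat and \<theta> :: real and a :: "nat \<Rightarrow> nat \<Rightarrow> real"
  assumes "n \<ge> 2"
    and "admissible_exponent n \<theta>"
    and "\<And>k. k \<ge> 1 \<Longrightarrow> minimising_cuboid n k (a k)"
  shows "(\<lambda>k. a k n - 1) \<in> O(\<lambda>k. real k powr ((\<theta> - (real n - 1)) / (2 * real n)))"
proof -
  let ?I = "{1..n}"
  let ?e = "(\<theta> - (real n - 1)) / (2 * real n)"
  have "1 \<le> n" using assms(1) by simp
  obtain lo k0 where lo: "0 < lo" "lo \<le> 1" "1 \<le> k0"
    and ge: "\<And>k j. k0 \<le> k \<Longrightarrow> j \<in> ?I \<Longrightarrow> lo \<le> a k j"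
    using minimising_cuboid_sides_ge[OF \<open>1 \<le> n\<close>] assms(3) by (metis order_trans)
  define hi where "hi = (1 / lo) ^ n"
  have "1 \<le> hi" using lo by (simp add: hi_def)
  have unit: "unit_cuboid n (a k)" if "k0 \<le> k" for k
    using assms(3)[of k] that lo(3) by (simp add: minimising_cuboid_def)
  have sides: "\<forall>j\<in>?I. a k j \<in> {lo..hi}" if "k0 \<le> k" for k
    using unit_cuboid_le[OF unit[OF that] _ lo(1,2)] ge[OF that] by (simp add: hi_def)
  show ?thesis
  proof (cases "real n - 1 \<le> \<theta>")
    case True
    \<comment> \<open>The exponent is nonnegative here, so boundedness of the longest side is
      enough.\<close>
    have "norm (a k n - 1) \<le> hi * norm (real k powr ?e)" if "k0 \<le> k" for k
    proof -
      have "\<bar>a k n - 1\<bar> \<le> hi"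
        using longest_side_deviation(1)[OF unit[OF that] \<open>1 \<le> n\<close>] sides[OF that] \<open>1 \<le> n\<close> by fastforce
      also have "\<dots> \<le> hi * real k powr ?e"
        using True that lo(3) \<open>1 \<le> hi\<close> ge_one_powr_ge_zero[of "real k" ?e] by simp
      finally show ?thesis by simp
    qed
    then show ?thesis by (intro bigoI[of _ hi] eventually_at_top_linorderI[of k0])
  next
    case False
    obtain C where C: "\<And>a \<mu> M. unit_cuboid n a \<Longrightarrow> \<forall>i\<in>?I. a i \<in> {lo..hi} \<Longrightarrow> 1 \<le> \<mu> \<Longrightarrow> hi * sqrt \<mu> \<le> real M \<Longrightarrow>
      riesz_sum {1..int M} ?I (\<lambda>_. 1) \<mu> \<le> riesz_sum {1..int M} ?I a \<mu> \<Longrightarrow>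
      (\<Sum>j=1..n. 1 / a j - 1) \<le> C * \<mu> powr ((\<theta> - (real n - 1)) / 2)"
      using sum_inverse_sides_le[OF assms(1,2) lo(1,2) \<open>1 \<le> hi\<close>] by blast
    have "norm (a k n - 1) \<le> 2 * hi * sqrt \<bar>C\<bar> * norm (real k powr ?e)" if k: "k0 \<le> k" for k
    proof -
      have "1 \<le> k" using k lo(3) by simp
      obtain \<mu> M0 where \<mu>: "0 < \<mu>" "real k \<le> sqrt \<mu> ^ n"
        and M0: "\<And>M. M0 \<le> M \<Longrightarrow> riesz_sum {1..int M} ?I (\<lambda>_. 1) \<mu> \<le> riesz_sum {1..int M} ?I (a k) \<mu>"
        using minimising_cuboid_riesz_sum[OF \<open>1 \<le> n\<close> \<open>1 \<le> k\<close> assms(3)[OF \<open>1 \<le> k\<close>]] by blast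
      \<comment> \<open>Large enough both for the comparison with the cube and for the box to
        contain the support for all sides up to \<open>hi\<close>.\<close>
      define M where "M = max M0 (nat \<lceil>hi * sqrt \<mu>\<rceil>)"
      have M: "M0 \<le> M" "hi * sqrt \<mu> \<le> real M" unfolding M_def by linarith+
      have "1 \<le> sqrt \<mu> ^ n" using \<mu>(2) \<open>1 \<le> k\<close> by linarith
      then have "1 \<le> sqrt \<mu>" using \<mu>(1) \<open>1 \<le> n\<close> by (meson less_imp_le not_le power_less_one_iff real_sqrt_ge_zero le_trans not_one_le_zero)
      then have "1 \<le> \<mu>" by simp
      let ?d = "(\<theta> - (real n - 1)) / 2"
      \<comment> \<open>The negative exponent reverses \<open>real k \<le> sqrt \<mu> ^ n\<close>.
        The square matches the quadratic bound of \<open>longest_side_deviation\<close> and is the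
        origin of the denominator \<open>2 * real n\<close>.\<close>
      have "\<mu> powr ?d \<le> (real k powr ?e)\<^sup>2"
      proof -
        have "(sqrt \<mu> ^ n) powr x = \<mu> powr (1 / 2 * (real n * x))" for x
          using \<mu>(1) by (simp add: powr_half_sqrt[symmetric] powr_realpow[symmetric] powr_powr)
        moreover have "?d = 1 / 2 * (real n * (2 * ?e))" using assms(1) by (simp add: field_simps)
        ultimately have "\<mu> powr ?d = (sqrt \<mu> ^ n) powr (2 * ?e)" by (simp only:)
        also have "\<dots> \<le> real k powr (2 * ?e)"
          using False \<mu>(2) \<open>1 \<le> k\<close> assms(1) by (intro powr_mono2') (auto simp: divide_nonpos_nonneg)
        also have "\<dots> = (real k powr ?e)\<^sup>2" by (simp only: power2_eq_square powr_add[symmetric] mult_2)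
        finally show ?thesis .
      qed
      have "(\<Sum>j=1..n. 1 / a k j - 1) \<le> C * \<mu> powr ?d"
        using unit[OF k] sides[OF k] \<open>1 \<le> \<mu>\<close> M(2) M0[OF M(1)] by (rule C)
      also have "\<dots> \<le> \<bar>C\<bar> * (real k powr ?e)\<^sup>2"
        using \<open>\<mu> powr ?d \<le> _\<close> by (intro mult_mono) auto
      finally have sum: "(\<Sum>j=1..n. 1 / a k j - 1) \<le> \<bar>C\<bar> * (real k powr ?e)\<^sup>2" .
      have "(a k n - 1)\<^sup>2 \<le> 4 * hi\<^sup>2 * (\<Sum>j=1..n. 1 / a k j - 1)"
        using unit[OF k] sides[OF k] \<open>1 \<le> n\<close> by (intro longest_side_deviation) auto
      also have "\<dots> \<le> 4 * hi\<^sup>2 * (\<bar>C\<bar> * (real k powr ?e)\<^sup>2)"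
        using sum by (intro mult_left_mono) auto
      also have "\<dots> = (2 * hi * sqrt \<bar>C\<bar> * real k powr ?e)\<^sup>2"
        by (simp add: power_mult_distrib)
      finally have "\<bar>a k n - 1\<bar> \<le> \<bar>2 * hi * sqrt \<bar>C\<bar> * real k powr ?e\<bar>"
        by (simp only: abs_le_square_iff)
      then show ?thesis using \<open>1 \<le> hi\<close> by (simp add: abs_mult)
    qed
    then show ?thesis
      by (intro bigoI[of _ "2 * hi * sqrt \<bar>C\<bar>"] eventually_at_top_linorderI[of k0])
  qed
qed

end
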